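(* Fix $x\in\Delta_d$ and $\alpha\in\mathbb{R}$, and suppose that $\kappa_1>0$, $\kappa_2>0$ and $\hat\Sigma\succ 0$. Consider the problem $$\text{(P)}\qquad \max_{P\in\mathcal{M}}\ \mathbb{E}_P[\hat K(x,\alpha,\xi)]\quad\text{s.t.}\quad \mathbb{E}_P\begin{bmatrix}-\hat\Sigma & \hat\mu-\xi\\ (\hat\mu-\xi)^\top & -\kappa_1\end{bmatrix}\preceq 0,\quad \mathbb{E}_P\big[(\xi-\hat\mu)(\xi-\hat\mu)^\top\big]\preceq\kappa_2\hat\Sigma,\quad \mathbb{E}_P[1]=1,$$ and the problem $$\text{(D)}\qquad \min_{r,q,\Lambda}\ r+h_1(x,\alpha,q,\Lambda)+\sqrt{\kappa_1}\,\big\|\hat\Sigma^{1/2}(q+2\Lambda\hat\mu)\big\|\quad\text{s.t.}\quad h_{2,\xi}(x,\alpha,q,\Lambda)\le r\ \ \forall \xi\in\Xi,\quad r\in\mathbb{R},\ q\in\mathbb{R}^{d+1},\ \Lambda\in\mathbb{S}_+^{d+1}.$$ Then (P) and its Lagrangian dual (D) are equivalent, in the sense that strong duality holds: their optimal values coincide. Moreover, the set of optimal solutions $(r,q,\Lambda)$ of (D) is nonempty and bounded.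
   Context: $\Delta_d=\{x\in\mathbb{R}^d : \sum_{i=1}^d x_i=1,\ x\ge 0\}$. $\mathbb{S}_+^{d+1}$ is the cone of symmetric positive semidefinite $(d+1)\times(d+1)$ matrices; $M\preceq N$ means $N-M$ is positive semidefinite; $\|\cdot\|$ is the Euclidean norm; $[t]_+=\max\{t,0\}$; $\langle M,N\rangle=\sum_{i,j}M_{i,j}N_{i,j}$. $\Xi\subseteq\mathbb{R}^{d+1}$ is a convex compact set with Borel $\sigma$-algebra, and $\mathcal{M}$ is the set of all Borel probability measures on $\Xi$. Elements are written $\xi=(\xi_B^\top,\xi_a)^\top$ with $\xi_B\in\mathbb{R}^d$, $\xi_a\in\mathbb{R}$. The vector $\hat\mu\in\mathbb{R}^{d+1}$ and the symmetric positive definite matrix $\hat\Sigma$ are the mean vector and covariance matrix of finitely many historical observations of the random vector $\xi$, all lying in $\Xi$. The function $\psi:\mathbb{R}\to\mathbb{R}$ is convex (for instance $\psi(a)=|a|$ or $\psi(a)=a^2$), $\tau_1,\tau_2\ge 0$, $\beta\in(0,1)$. Define $$\hat K(x,\alpha,\xi)=\psi(\xi_a-\xi_B^\top x)+\frac{\tau_2}{1-\beta}\big[-x^\top\xi_B-\alpha\big]_++\tau_1\|x\|^2+\tau_2\alpha,$$ $$h_1(x,\alpha,q,\Lambda)=\langle\kappa_2\hat\Sigma,\Lambda\rangle+(\Lambda^\top\hat\mu+q)^\top\hat\mu+\tau_1\|x\|^2+\tau_2\alpha,$$ $$h_{2,\xi}(x,\alpha,q,\Lambda)=\psi(\xi_a-\xi_B^\top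 x)-(\Lambda^\top\xi+q)^\top\xi+\frac{\tau_2}{1-\beta}\big[-x^\top\xi_B-\alpha\big]_+.$$ *)

theory Defs
  imports "HOL-Probability.Probability"
begin

definition psd :: "real^'n^'n \<Rightarrow> bool" where
  "psd M \<longleftrightarrow> transpose M = M \<and> (\<forall>v. 0 \<le> v \<bullet> (M *v v))"

definition pos_def :: "real^'n^'n \<Rightarrow> bool" where
  "pos_def M \<longleftrightarrow> transpose M = M \<and> (\<forall>v. v \<noteq> 0 \<longrightarrow> 0 < v \<bullet> (M *v v))"

definition loewner_le :: "real^'n^'n \<Rightarrow> real^'n^'n \<Rightarrow> bool"  (infix \<open>\<preceq>\<^sub>L\<close> 50) where
  "M \<preceq>\<^sub>L N \<longleftrightarrow> psd (N - M)"

text \<open>The positive semidefinite square root, meaningful for positive semidefinite \<open>M\<close>.\<close>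

definition mat_sqrt :: "real^'n^'n \<Rightarrow> real^'n^'n" where
  "mat_sqrt M = (THE S. psd S \<and> S ** S = M)"

definition outer :: "real^'n \<Rightarrow> real^'n \<Rightarrow> real^'n^'n" where
  "outer v w = (\<chi> i j. v $ i * w $ j)"

definition sample_mean :: "(real^'n) list \<Rightarrow> real^'n" where
  "sample_mean obs = (1 / real (length obs)) *\<^sub>R (\<Sum>z\<leftarrow>obs. z)"

text \<open>The divisor \<open>m\<close> is a parameter because both \<open>length obs\<close> and \<open>length obs - 1\<close> are in
  common use as normalisations of the covariance matrix of a list of observations.\<close>

definition sample_covariance :: "nat \<Rightarrow> (real^'n) list \<Rightarrow> real^'n^'n" where
  "sample_covariance m obs =
     (1 / real m) *\<^sub>R (\<Sum>z\<leftarrow>obs. outer (z - sample_mean obs) (z - sample_mean obs))"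

definition std_simplex :: "(real^'d) set" where
  "std_simplex = {x. (\<Sum>i\<in>UNIV. x $ i) = 1 \<and> (\<forall>i. 0 \<le> x $ i)}"

text \<open>For a finite index type \<open>'d\<close> with \<open>d\<close> elements, vectors with \<open>d + 1\<close> components are indexed by
  \<open>'d option\<close>: the components at \<open>Some i\<close> form \<open>\<xi>\<^sub>B\<close> and the component at \<open>None\<close> is \<open>\<xi>\<^sub>a\<close>.\<close>

definition part_B :: "real^('d::finite option) \<Rightarrow> real^'d" where
  "part_B \<xi> = (\<chi> i. \<xi> $ Some i)"

definition part_a :: "real^('d::finite option) \<Rightarrow> real" where
  "part_a \<xi> = \<xi> $ None"

definition K_hat ::
  "(real \<Rightarrow> real) \<Rightarrow> real \<Rightarrow> real \<Rightarrow> real \<Rightarrow> real^'d \<Rightarrow> real \<Rightarrow> real^('d::finite option) \<Rightarrow> real" where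
  "K_hat \<psi> \<tau>1 \<tau>2 \<beta> x \<alpha> \<xi> =
     \<psi> (part_a \<xi> - part_B \<xi> \<bullet> x)
     + \<tau>2 / (1 - \<beta>) * max (- (x \<bullet> part_B \<xi>) - \<alpha>) 0
     + \<tau>1 * (norm x)\<^sup>2 + \<tau>2 * \<alpha>"

text \<open>The inner product of \<open>real^'n^'n\<close> is the entrywise one, so the first summand is the
  trace inner product of \<open>\<kappa>\<^sub>2 \<Sigma>\<close> and \<open>\<Lambda>\<close>.\<close>

definition h1 ::
  "real \<Rightarrow> real \<Rightarrow> real^('d::finite option) \<Rightarrow> real^('d::finite option)^('d::finite option) \<Rightarrow> real
   \<Rightarrow> real^'d \<Rightarrow> real \<Rightarrow> real^('d::finite option) \<Rightarrow> real^('d::finite option)^('d::finite option) \<Rightarrow> real" where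
  "h1 \<tau>1 \<tau>2 \<mu> \<Sigma> \<kappa>2 x \<alpha> q \<Lambda> =
     (\<kappa>2 *\<^sub>R \<Sigma>) \<bullet> \<Lambda> + (transpose \<Lambda> *v \<mu> + q) \<bullet> \<mu> + \<tau>1 * (norm x)\<^sup>2 + \<tau>2 * \<alpha>"

definition h2 ::
  "(real \<Rightarrow> real) \<Rightarrow> real \<Rightarrow> real \<Rightarrow> real^('d::finite option)
   \<Rightarrow> real^'d \<Rightarrow> real \<Rightarrow> real^('d::finite option) \<Rightarrow> real^('d::finite option)^('d::finite option) \<Rightarrow> real" where
  "h2 \<psi> \<tau>2 \<beta> \<xi> x \<alpha> q \<Lambda> =
     \<psi> (part_a \<xi> - part_B \<xi> \<bullet> x) - (transpose \<Lambda> *v \<xi> + q) \<bullet> \<xi>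
     + \<tau>2 / (1 - \<beta>) * max (- (x \<bullet> part_B \<xi>) - \<alpha>) 0"

definition borel_prob_measures :: "'a::topological_space set \<Rightarrow> 'a measure set" where
  "borel_prob_measures \<Xi> = {P. sets P = sets (restrict_space borel \<Xi>) \<and> prob_space P}"

text \<open>The \<open>(d + 2) \<times> (d + 2)\<close> block matrix with rows \<open>[-\<Sigma>, \<mu> - \<xi>]\<close> and \<open>[(\<mu> - \<xi>)\<^sup>T, -\<kappa>\<^sub>1]\<close>;
  the additional row and column have index \<open>None\<close>.\<close>

definition moment_block ::
  "real^'n \<Rightarrow> real^'n^'n \<Rightarrow> real \<Rightarrow> real^'n \<Rightarrow> real^('n::finite option)^('n::finite option)" where
  "moment_block \<mu> \<Sigma> \<kappa>1 \<xi> = (\<chi> i j.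
     case i of
       Some k \<Rightarrow> (case j of Some l \<Rightarrow> - (\<Sigma> $ k $ l) | None \<Rightarrow> (\<mu> - \<xi>) $ k)
     | None \<Rightarrow> (case j of Some l \<Rightarrow> (\<mu> - \<xi>) $ l | None \<Rightarrow> - \<kappa>1))"

text \<open>Matrix-valued expectations are Bochner integrals in \<open>real^'n^'n\<close>, i.e. entrywise.\<close>

definition primal_feasible ::
  "(real^'n) set \<Rightarrow> real^'n \<Rightarrow> real^'n^'n \<Rightarrow> real \<Rightarrow> real \<Rightarrow> (real^'n) measure set" where
  "primal_feasible \<Xi> \<mu> \<Sigma> \<kappa>1 \<kappa>2 = {P \<in> borel_prob_measures \<Xi>.
     (LINT \<xi>|P. moment_block \<mu> \<Sigma> \<kappa>1 \<xi>) \<preceq>\<^sub>L 0 \<and>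
     (LINT \<xi>|P. outer (\<xi> - \<mu>) (\<xi> - \<mu>)) \<preceq>\<^sub>L \<kappa>2 *\<^sub>R \<Sigma> \<and>
     (LINT \<xi>|P. (1::real)) = 1}"

definition primal_value ::
  "(real \<Rightarrow> real) \<Rightarrow> real \<Rightarrow> real \<Rightarrow> real \<Rightarrow> (real^('d::finite option)) set
   \<Rightarrow> real^('d::finite option) \<Rightarrow> real^('d::finite option)^('d::finite option) \<Rightarrow> real \<Rightarrow> real
   \<Rightarrow> real^'d \<Rightarrow> real \<Rightarrow> ereal" where
  "primal_value \<psi> \<tau>1 \<tau>2 \<beta> \<Xi> \<mu> \<Sigma> \<kappa>1 \<kappa>2 x \<alpha> =
     (SUP P \<in> primal_feasible \<Xi> \<mu> \<Sigma> \<kappa>1 \<kappa>2. ereal (LINT \<xi>|P. K_hat \<psi> \<tau>1 \<tau>2 \<beta> x \<alpha> \<xi>))"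

definition dual_feasible ::
  "(real \<Rightarrow> real) \<Rightarrow> real \<Rightarrow> real \<Rightarrow> (real^('d::finite option)) set \<Rightarrow> real^'d \<Rightarrow> real
   \<Rightarrow> (real \<times> (real^('d::finite option)) \<times> (real^('d::finite option)^('d::finite option))) set" where
  "dual_feasible \<psi> \<tau>2 \<beta> \<Xi> x \<alpha> =
     {(r, q, \<Lambda>). psd \<Lambda> \<and> (\<forall>\<xi>\<in>\<Xi>. h2 \<psi> \<tau>2 \<beta> \<xi> x \<alpha> q \<Lambda> \<le> r)}"

fun dual_objective ::
  "real \<Rightarrow> real \<Rightarrow> real^('d::finite option) \<Rightarrow> real^('d::finite option)^('d::finite option) \<Rightarrow> real \<Rightarrow> real
   \<Rightarrow> real^'d \<Rightarrow> real
   \<Rightarrow> real \<times> (real^('d::finite option)) \<times> (real^('d::finite option)^('d::finite option)) \<Rightarrow> real" where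
  "dual_objective \<tau>1 \<tau>2 \<mu> \<Sigma> \<kappa>1 \<kappa>2 x \<alpha> (r, q, \<Lambda>) =
     r + h1 \<tau>1 \<tau>2 \<mu> \<Sigma> \<kappa>2 x \<alpha> q \<Lambda>
     + sqrt \<kappa>1 * norm (mat_sqrt \<Sigma> *v (q + 2 *\<^sub>R (\<Lambda> *v \<mu>)))"

definition dual_value ::
  "(real \<Rightarrow> real) \<Rightarrow> real \<Rightarrow> real \<Rightarrow> real \<Rightarrow> (real^('d::finite option)) set
   \<Rightarrow> real^('d::finite option) \<Rightarrow> real^('d::finite option)^('d::finite option) \<Rightarrow> real \<Rightarrow> real
   \<Rightarrow> real^'d \<Rightarrow> real \<Rightarrow> ereal" where
  "dual_value \<psi> \<tau>1 \<tau>2 \<beta> \<Xi> \<mu> \<Sigma> \<kappa>1 \<kappa>2 x \<alpha> =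
     (INF z \<in> dual_feasible \<psi> \<tau>2 \<beta> \<Xi> x \<alpha>. ereal (dual_objective \<tau>1 \<tau>2 \<mu> \<Sigma> \<kappa>1 \<kappa>2 x \<alpha> z))"

definition dual_solutions ::
  "(real \<Rightarrow> real) \<Rightarrow> real \<Rightarrow> real \<Rightarrow> real \<Rightarrow> (real^('d::finite option)) set
   \<Rightarrow> real^('d::finite option) \<Rightarrow> real^('d::finite option)^('d::finite option) \<Rightarrow> real \<Rightarrow> real
   \<Rightarrow> real^'d \<Rightarrow> real
   \<Rightarrow> (real \<times> (real^('d::finite option)) \<times> (real^('d::finite option)^('d::finite option))) set" where
  "dual_solutions \<psi> \<tau>1 \<tau>2 \<beta> \<Xi> \<mu> \<Sigma> \<kappa>1 \<kappa>2 x \<alpha> =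
     {z \<in> dual_feasible \<psi> \<tau>2 \<beta> \<Xi> x \<alpha>. \<forall>z' \<in> dual_feasible \<psi> \<tau>2 \<beta> \<Xi> x \<alpha>.
        dual_objective \<tau>1 \<tau>2 \<mu> \<Sigma> \<kappa>1 \<kappa>2 x \<alpha> z \<le> dual_objective \<tau>1 \<tau>2 \<mu> \<Sigma> \<kappa>1 \<kappa>2 x \<alpha> z'}"

end

theory Submission
  imports Defs
begin

text \<open>After centring at the mean \<open>\<mu>\<close>, weak duality is the integral of the dual constraint. Conversely,
  the feasible moments with a value above the primal optimum are disjoint from the convex hull of
  the moments of point masses, and a separating hyperplane in the finite-dimensional space of
  moments is an optimal dual point. The point mass at \<open>\<mu>\<close> is strictly feasible: this excludes a
  vertical hyperplane, and the dual constraint at \<open>\<xi> = \<mu>\<close> bounds the optimal set.\<close>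

section \<open>Positive semidefinite matrices\<close>

text \<open>The primal value is treated as a supremum, without an optimal measure: only moments with
  a value strictly above it are separated from the hull, so the sets are disjoint by the choice of
  the level, and letting the value tend to that level bounds the dual objective. The norm term of
  the dual is a support function. By a Schur complement the block constraint confines the mean of
  \<xi> - \<mu> to an ellipsoid, and the largest value of b . u over that ellipsoid is sqrt
  (\<kappa>1 * (b . \<Sigma> b)). To identify this with the norm in \<open>dual_objective\<close>,
  existence and uniqueness of the root are shown first, since \<open>mat_sqrt\<close> is a definite
  description.\<close>

lemma transpose_eq_inner:
  fixes M :: "real^'n^'n"
  shows "transpose M = M \<longleftrightarrow> (\<forall>v w. v \<bullet> (M *v w) = (M *v v) \<bullet> w)"
proof
  assume "transpose M = M"
  then show "\<forall>v w. v \<bullet> (M *v w) = (M *v v) \<bullet> w"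
    by (metis dot_lmul_matrix transpose_matrix_vector)
next
  assume *: "\<forall>v w. v \<bullet> (M *v w) = (M *v v) \<bullet> w"
  have "transpose M *v v = M *v v" for v
    by (rule vector_eq_rdot[THEN iffD1]) (metis * dot_lmul_matrix transpose_matrix_vector)
  then show "transpose M = M"
    by (simp add: matrix_eq)
qed

lemma psd_inner_commute: "psd M \<Longrightarrow> v \<bullet> (M *v w) = (M *v v) \<bullet> w"
  unfolding psd_def transpose_eq_inner by blast

lemma pos_def_imp_psd: "pos_def M \<Longrightarrow> psd M"
  unfolding pos_def_def psd_def by (metis inner_zero_left order_less_imp_le order_refl)

text \<open>The constant is the minimum of the form on the unit sphere, which is attained by
  compactness and hence positive; homogeneity does the rest.\<close>

lemma pos_def_coercive:
  fixes M :: "real^'n^'n"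
  assumes "pos_def M"
  obtains a where "0 < a" "\<And>v. a * (norm v)\<^sup>2 \<le> v \<bullet> (M *v v)"
proof -
  have "continuous_on (sphere 0 1) (\<lambda>v. v \<bullet> (M *v v))"
    by (intro continuous_intros linear_continuous_on matrix_vector_mul_bounded_linear)
  moreover have "sphere (0::real^'n) 1 \<noteq> {}"
    by simp
  ultimately obtain u where u: "u \<in> sphere 0 1"
    and min: "\<And>v. v \<in> sphere 0 1 \<Longrightarrow> u \<bullet> (M *v u) \<le> v \<bullet> (M *v v)"
    using continuous_attains_inf[OF compact_sphere] by blast
  show thesis
  proof (rule that)
    show "0 < u \<bullet> (M *v u)"
      using u assms unfolding pos_def_def by (metis dist_self mem_sphere zero_neq_one)
    fix v :: "real^'n"
    show "(u \<bullet> (M *v u)) * (norm v)\<^sup>2 \<le> v \<bullet> (M *v v)"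
    proof (cases "v = 0")
      case False
      then have "(1 / norm v) *\<^sub>R v \<in> sphere 0 1"
        by simp
      from min[OF this] have "u \<bullet> (M *v u) \<le> (1 / norm v)\<^sup>2 * (v \<bullet> (M *v v))"
        by (simp add: matrix_vector_mult_scaleR power2_eq_square field_simps)
      then show ?thesis
        using False by (simp add: field_simps power_divide)
    qed simp
  qed
qed

text \<open>Near 0 the linear term dominates and changes sign with t. The choice of D above both 0
  and d makes the value at t = -c/D negative unless c = 0.\<close>

lemma quadratic_vanish_linear:
  fixes c d :: real
  assumes "\<And>t. 0 \<le> t * c + t\<^sup>2 * d"
  shows "c = 0"
proof (rule ccontr)
  assume c: "c \<noteq> 0"
  define D where "D = \<bar>d\<bar> + 1"
  have D: "D > 0" "d < D"
    unfolding D_def by auto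
  have "0 \<le> (- c / D) * c + (- c / D)\<^sup>2 * d"
    by (rule assms)
  also have "\<dots> = (c\<^sup>2 / D\<^sup>2) * (d - D)"
    using D by (simp add: field_simps power2_eq_square)
  also have "\<dots> < 0"
    using D c by (intro mult_pos_neg) auto
  finally show False
    by simp
qed

text \<open>Such a v minimises the form, so the derivative in the direction M v, which is twice the
  squared norm of M v, must vanish.\<close>

lemma psd_quadratic_form_eq_0:
  assumes "psd M" "v \<bullet> (M *v v) = 0"
  shows "M *v v = 0"
proof -
  let ?w = "M *v v"
  have "0 \<le> t * (2 * (?w \<bullet> ?w)) + t\<^sup>2 * (?w \<bullet> (M *v ?w))" for t
  proof -
    have "0 \<le> (v + t *\<^sub>R ?w) \<bullet> (M *v (v + t *\<^sub>R ?w))"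
      using assms(1) unfolding psd_def by blast
    also have "\<dots> = t * (2 * (?w \<bullet> ?w)) + t\<^sup>2 * (?w \<bullet> (M *v ?w))"
      using assms(2) psd_inner_commute[OF assms(1), of v ?w]
      by (simp add: matrix_vector_right_distrib matrix_vector_mult_scaleR inner_add_left
          inner_add_right power2_eq_square algebra_simps)
    finally show ?thesis .
  qed
  from quadratic_vanish_linear[OF this] show ?thesis
    by simp
qed

section \<open>Square roots of positive definite matrices\<close>

lemma trace_axis:
  fixes M :: "real^'n^'n"
  shows "(\<Sum>i\<in>UNIV. axis i 1 \<bullet> (M *v axis i 1)) = trace M"
  by (simp add: trace_def inner_axis' matrix_vector_mult_basis column_def)

text \<open>With \<open>D = S - T\<close> one has \<open>D S + T D = 0\<close>; multiplying by \<open>D\<close> and taking traces,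
  \<open>tr (D S D) + tr (D T D) = 0\<close>, and both summands are nonnegative.\<close>

lemma psd_sqrt_unique:
  fixes S T :: "real^'n^'n"
  assumes S: "psd S" and T: "psd T" and eq: "S ** S = T ** T"
  shows "S = T"
proof -
  define D where "D = S - T"
  have Dv: "D *v v = S *v v - T *v v" for v
    by (simp add: D_def matrix_vector_mult_diff_rdistrib)
  have symD: "v \<bullet> (D *v w) = (D *v v) \<bullet> w" for v w
    by (simp add: Dv inner_diff_left inner_diff_right psd_inner_commute[OF S]
        psd_inner_commute[OF T])
  have form: "(D *v v) \<bullet> (S *v (D *v v)) = v \<bullet> (D ** S ** D *v v)"
    "(D *v v) \<bullet> (T *v (D *v v)) = v \<bullet> (D ** T ** D *v v)" for v
    by (simp_all add: symD flip: matrix_vector_mul_assoc)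
  have "S *v (S *v v) = T *v (T *v v)" for v
    by (simp add: matrix_vector_mul_assoc eq)
  then have "D ** S + T ** D = 0"
    by (simp add: matrix_eq matrix_vector_mult_add_rdistrib Dv matrix_vector_mult_diff_distrib
        flip: matrix_vector_mul_assoc)
  then have "trace (D ** (D ** S + T ** D)) = 0"
    by (simp add: trace_def)
  then have "trace (D ** (D ** S)) + trace (D ** T ** D) = 0"
    by (simp add: matrix_add_ldistrib trace_add matrix_mul_assoc)
  moreover have "trace (D ** (D ** S)) = trace (D ** S ** D)"
    by (rule trace_mul_sym)
  ultimately have "(\<Sum>i\<in>UNIV. (D *v axis i 1) \<bullet> (S *v (D *v axis i 1))
      + (D *v axis i 1) \<bullet> (T *v (D *v axis i 1))) = 0"
    by (simp add: form trace_axis sum.distrib)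
  moreover have nn: "0 \<le> v \<bullet> (S *v v)" "0 \<le> v \<bullet> (T *v v)" for v
    using S T unfolding psd_def by blast+
  ultimately have *: "(D *v axis i 1) \<bullet> (S *v (D *v axis i 1))
      + (D *v axis i 1) \<bullet> (T *v (D *v axis i 1)) = 0" for i
    by (subst (asm) sum_nonneg_eq_0_iff) auto
  \<comment> \<open>S and T both annihilate D e_i, hence so does D, and by symmetry the squared norm
    of D e_i is e_i . D (D e_i) = 0.\<close>
  have "D *v axis i 1 = 0" for i
  proof -
    have "S *v (D *v axis i 1) = 0" "T *v (D *v axis i 1) = 0"
      using *[of i] nn[of "D *v axis i 1"] S T
      by (auto intro!: psd_quadratic_form_eq_0)
    then have "D *v (D *v axis i 1) = 0"
      by (simp add: Dv[of "D *v axis i 1"])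
    then have "(D *v axis i 1) \<bullet> (D *v axis i 1) = 0"
      by (metis symD inner_zero_right)
    then show ?thesis
      by simp
  qed
  then have "column i D = 0" for i
    by (simp add: matrix_vector_mult_basis)
  then have "D = 0"
    by (simp add: column_def vec_eq_iff)
  then show ?thesis
    by (simp add: D_def)
qed

text \<open>Rescaled to \<open>\<epsilon> M = I - B\<close> with \<open>\<parallel>B\<parallel> < 1\<close>, the square root is \<open>I - Y\<close>, where \<open>Y\<close> is the
  fixed point of the contraction \<open>Y \<mapsto> (B + Y\<^sup>2) / 2\<close> on the self-adjoint operators
  of norm at most \<open>\<parallel>B\<parallel>\<close>.\<close>

lemma pos_def_sqrt_exists:
  fixes M :: "real^'n^'n"
  assumes M: "pos_def M"
  shows "\<exists>S. psd S \<and> S ** S = M"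
proof -
  obtain a where a: "0 < a" "\<And>v. a * (norm v)\<^sup>2 \<le> v \<bullet> (M *v v)"
    using pos_def_coercive[OF M] by blast
  obtain K0 where K0: "K0 > 0" "\<And>v. norm (M *v v) \<le> norm v * K0"
    using bounded_linear.pos_bounded[OF matrix_vector_mul_bounded_linear[of M]] by blast
  \<comment> \<open>The summand a makes K strictly larger than a, so that the contraction constant
    \<rho> below is real and less than 1.\<close>
  define K where "K = K0 + a"
  have K: "norm (M *v v) \<le> K * norm v" for v
    using K0(2)[of v] a(1) by (simp add: K_def algebra_simps add_increasing2)
  have "0 < K" "a < K"
    using K0 a by (auto simp: K_def)
  \<comment> \<open>This e minimises 1 - 2 e a + e^2 K^2, the bound for the squared norm of I - e M;
    the minimum 1 - a^2 / K^2 is the square of \<rho>.\<close>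
  define e where "e = a / K\<^sup>2"
  have "e > 0"
    using a \<open>0 < K\<close> by (simp add: e_def)
  define \<rho> where "\<rho> = sqrt (1 - a\<^sup>2 / K\<^sup>2)"
  have "a\<^sup>2 / K\<^sup>2 < 1" "0 < a\<^sup>2 / K\<^sup>2"
    using a \<open>a < K\<close> by (auto simp: power_strict_mono)
  then have \<rho>: "0 \<le> \<rho>" "\<rho> < 1" "\<rho>\<^sup>2 = 1 - a\<^sup>2 / K\<^sup>2"
    by (auto simp: \<rho>_def)
  define B where "B = Blinfun (\<lambda>v. v - e *\<^sub>R (M *v v))"
  have B: "B v = v - e *\<^sub>R (M *v v)" for v
    unfolding B_def
    by (simp add: bounded_linear_Blinfun_apply bounded_linear_sub bounded_linear_const_scaleR)
  have "norm (B v) \<le> \<rho> * norm v" for v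
  proof (rule power2_le_imp_le)
    have "(norm (B v))\<^sup>2 = (norm v)\<^sup>2 - 2 * e * (v \<bullet> (M *v v)) + e\<^sup>2 * (norm (M *v v))\<^sup>2"
      unfolding B power2_norm_eq_inner
      by (simp add: inner_diff_left inner_diff_right inner_commute power2_eq_square algebra_simps)
    also have "\<dots> \<le> (norm v)\<^sup>2 - 2 * e * (a * (norm v)\<^sup>2) + e\<^sup>2 * (K * norm v)\<^sup>2"
      using a(2)[of v] K[of v] \<open>e > 0\<close>
      by (intro add_mono diff_mono mult_left_mono power_mono) auto
    also have "\<dots> = (norm v)\<^sup>2 * (1 - a\<^sup>2 / K\<^sup>2)"
      using \<open>0 < K\<close> by (simp add: e_def field_simps power2_eq_square)
    also have "\<dots> = (\<rho> * norm v)\<^sup>2"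
      by (simp add: \<rho>(3) power_mult_distrib mult.commute)
    finally show "(norm (B v))\<^sup>2 \<le> (\<rho> * norm v)\<^sup>2" .
  qed (simp add: \<rho>)
  then have normB: "norm B \<le> \<rho>"
    using \<rho> by (intro norm_blinfun_bound)
  \<comment> \<open>The ball is invariant under the iteration because (\<rho> + \<rho>^2) / 2 <=
    \<rho>; self-adjointness is a closed condition and survives in the limit.\<close>
  define X where "X = cball 0 \<rho> \<inter> (\<Inter>v w. {Y :: (real^'n) \<Rightarrow>\<^sub>L (real^'n). Y v \<bullet> w = v \<bullet> Y w})"
  define f where "f Y = (1/2) *\<^sub>R (B + (Y o\<^sub>L Y))" for Y
  have "closed X"
    unfolding X_def
    by (intro closed_Int closed_cball closed_INT ballI closed_Collect_eq continuous_intros)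
  then have "\<exists>!Y\<in>X. f Y = Y"
  proof (rule Banach_fix[OF complete_eq_closed[THEN iffD2] _ \<rho>(1,2)])
    show "X \<noteq> {}"
    proof -
      have "0 \<in> X"
        using \<rho> by (simp add: X_def)
      then show ?thesis
        by blast
    qed
    show "f ` X \<subseteq> X"
    proof
      fix Z assume "Z \<in> f ` X"
      then obtain Y where Y: "Y \<in> X" "Z = f Y"
        by blast
      then have nY: "norm Y \<le> \<rho>" and sY: "\<And>v w. Y v \<bullet> w = v \<bullet> Y w"
        by (auto simp: X_def)
      have "norm (Y o\<^sub>L Y) \<le> \<rho> * 1"
        using norm_blinfun_compose[of Y Y] mult_mono[OF nY, of "norm Y" 1] nY \<rho> by simp
      then have "norm (B + (Y o\<^sub>L Y)) \<le> 2 * \<rho>"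
        using normB norm_triangle_ineq[of B "Y o\<^sub>L Y"] by simp
      then have "norm Z \<le> \<rho>"
        by (simp add: Y(2) f_def)
      moreover have "B v \<bullet> w = v \<bullet> B w" for v w
        by (simp add: B inner_diff_left inner_diff_right
            psd_inner_commute[OF pos_def_imp_psd[OF M]])
      then have "Z v \<bullet> w = v \<bullet> Z w" for v w
        by (simp add: Y(2) f_def blinfun.bilinear_simps inner_add_left inner_add_right sY)
      ultimately show "Z \<in> X"
        by (simp add: X_def)
    qed
    fix Y Z assume "Y \<in> X" "Z \<in> X"
    then have n: "norm Y \<le> \<rho>" "norm Z \<le> \<rho>"
      by (auto simp: X_def)
    \<comment> \<open>The difference of squares is split so that Y and Z need not commute.\<close>
    have "f Y - f Z = (1/2) *\<^sub>R ((Y o\<^sub>L (Y - Z)) + ((Y - Z) o\<^sub>L Z))"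
      by (rule blinfun_eqI) (simp add: f_def blinfun.bilinear_simps algebra_simps)
    then have "dist (f Y) (f Z) = (1/2) * norm ((Y o\<^sub>L (Y - Z)) + ((Y - Z) o\<^sub>L Z))"
      by (simp add: dist_norm)
    also have "\<dots> \<le> (1/2) * (norm Y * norm (Y - Z) + norm (Y - Z) * norm Z)"
      by (intro mult_left_mono order_trans[OF norm_triangle_ineq] add_mono norm_blinfun_compose)
        auto
    also have "\<dots> \<le> (1/2) * (\<rho> * norm (Y - Z) + norm (Y - Z) * \<rho>)"
      using n \<rho> by (intro mult_left_mono add_mono mult_mono) auto
    finally show "dist (f Y) (f Z) \<le> \<rho> * dist Y Z"
      by (simp add: dist_norm)
  qed
  then obtain Y where "Y \<in> X" and fp: "f Y = Y"
    by blast
  then have nY: "norm Y \<le> \<rho>" and sY: "\<And>v w. Y v \<bullet> w = v \<bullet> Y w"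
    by (auto simp: X_def)
  \<comment> \<open>The fixed point equation solved for Y^2; it gives (I - Y)^2 = I - B = e
    M.\<close>
  have YY: "Y (Y v) = 2 *\<^sub>R Y v - B v" for v
  proof -
    have "2 *\<^sub>R Y v = 2 *\<^sub>R f Y v"
      by (simp add: fp)
    then show ?thesis
      by (simp add: f_def blinfun.bilinear_simps)
  qed
  define S where "S = matrix (\<lambda>v. (1 / sqrt e) *\<^sub>R (v - Y v))"
  have S: "S *v v = (1 / sqrt e) *\<^sub>R (v - Y v)" for v
    unfolding S_def
    by (rule fun_cong[OF matrix_vector_mul(3)]) (intro bounded_linear_intros)
  have "psd S"
    unfolding psd_def
  proof
    show "transpose S = S"
      by (simp add: transpose_eq_inner S inner_diff_left inner_diff_right sY)
    show "\<forall>v. 0 \<le> v \<bullet> (S *v v)"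
    proof
      fix v
      have "v \<bullet> Y v \<le> norm v * norm (Y v)"
        by (rule norm_cauchy_schwarz)
      also have "\<dots> \<le> norm v * (1 * norm v)"
        using norm_blinfun[of Y v] nY \<rho>
        by (intro mult_left_mono order_trans[OF norm_blinfun] mult_right_mono) auto
      finally have "0 \<le> v \<bullet> (v - Y v)"
        by (simp add: inner_diff_right power2_norm_eq_inner[symmetric] power2_eq_square)
      then show "0 \<le> v \<bullet> (S *v v)"
        using \<open>e > 0\<close> by (simp add: S)
    qed
  qed
  moreover have "S ** S = M"
  proof -
    have "S *v (S *v v) = M *v v" for v
    proof -
      have "S *v (S *v v) = (1 / e) *\<^sub>R (v - Y v - Y v + Y (Y v))"
        using \<open>e > 0\<close> by (simp add: S blinfun.bilinear_simps algebra_simps)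
      also have "\<dots> = M *v v"
        using \<open>e > 0\<close> by (simp add: YY B scaleR_2)
      finally show ?thesis .
    qed
    then show ?thesis
      by (simp add: matrix_eq matrix_vector_mul_assoc)
  qed
  ultimately show ?thesis
    by blast
qed

lemma mat_sqrt_pos_def:
  fixes M :: "real^'n^'n"
  assumes "pos_def M"
  shows "psd (mat_sqrt M)" "mat_sqrt M ** mat_sqrt M = M"
proof -
  have "\<exists>!S. psd S \<and> S ** S = M"
    using pos_def_sqrt_exists[OF assms] psd_sqrt_unique by metis
  from theI'[OF this] show "psd (mat_sqrt M)" "mat_sqrt M ** mat_sqrt M = M"
    unfolding mat_sqrt_def by auto
qed

lemma inner_mat_sqrt:
  fixes M :: "real^'n^'n"
  assumes "pos_def M"
  shows "(mat_sqrt M *v v) \<bullet> (mat_sqrt M *v w) = v \<bullet> (M *v w)"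
  using psd_inner_commute[OF mat_sqrt_pos_def(1)[OF assms], of v "mat_sqrt M *v w"]
  by (simp add: matrix_vector_mul_assoc mat_sqrt_pos_def(2)[OF assms])

lemma norm_mat_sqrt:
  assumes "pos_def M"
  shows "norm (mat_sqrt M *v v) = sqrt (v \<bullet> (M *v v))"
  by (simp add: norm_eq_sqrt_inner inner_mat_sqrt[OF assms])

lemma pos_def_cauchy_schwarz:
  assumes "pos_def M"
  shows "v \<bullet> (M *v w) \<le> sqrt (v \<bullet> (M *v v)) * sqrt (w \<bullet> (M *v w))"
  using norm_cauchy_schwarz[of "mat_sqrt M *v v" "mat_sqrt M *v w"]
  by (simp add: inner_mat_sqrt[OF assms] norm_mat_sqrt[OF assms])

section \<open>Rank-one matrices and the trace inner product\<close>

lemma inner_outer: "M \<bullet> outer v w = v \<bullet> (M *v w)"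
  by (simp add: inner_vec_def outer_def matrix_vector_mult_def sum_distrib_left algebra_simps)

lemma outer_mult_vec: "outer v w *v u = (w \<bullet> u) *\<^sub>R v"
  by (simp add: vec_eq_iff outer_def matrix_vector_mult_def inner_vec_def sum_distrib_left
      algebra_simps)

lemma matrix_mult_outer:
  fixes R :: "real^'n^'n"
  shows "R ** transpose R = (\<Sum>k\<in>UNIV. outer (column k R) (column k R))"
  by (simp add: vec_eq_iff matrix_matrix_mult_def outer_def column_def transpose_def)

text \<open>The root of N writes N as a sum of rank-one matrices v v^T, and pairing M with each of
  them gives v . M v.\<close>

lemma psd_inner_pos_def_nonneg:
  fixes M N :: "real^'n^'n"
  assumes "psd M" "pos_def N"
  shows "0 \<le> M \<bullet> N"
proof -
  let ?R = "mat_sqrt N"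
  have "N = (\<Sum>k\<in>UNIV. outer (column k ?R) (column k ?R))"
    using mat_sqrt_pos_def[OF assms(2)] matrix_mult_outer[of ?R] by (simp add: psd_def)
  then have "M \<bullet> N = (\<Sum>k\<in>UNIV. column k ?R \<bullet> (M *v column k ?R))"
    by (metis (no_types, lifting) inner_outer inner_sum_right sum.cong)
  also have "\<dots> \<ge> 0"
    using assms(1) by (intro sum_nonneg) (simp add: psd_def)
  finally show ?thesis .
qed

text \<open>The factorisation by the root is available for positive definite matrices, so N is
  perturbed to N + e I and e tends to 0.\<close>

lemma psd_inner_nonneg:
  fixes M N :: "real^'n^'n"
  assumes "psd M" "psd N"
  shows "0 \<le> M \<bullet> N"
proof (rule tendsto_lowerbound)
  show "((\<lambda>e. M \<bullet> (N + e *\<^sub>R mat 1)) \<longlongrightarrow> M \<bullet> N) (at_right 0)"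
    by (auto intro!: tendsto_eq_intros)
  have "pos_def (N + e *\<^sub>R mat 1)" if "e > 0" for e
    using assms(2) that
    by (auto simp: psd_def pos_def_def transpose_eq_inner matrix_vector_mult_add_rdistrib
        inner_add_left inner_add_right scaleR_matrix_vector_assoc[symmetric] add_nonneg_pos)
  then show "\<forall>\<^sub>F e in at_right 0. 0 \<le> M \<bullet> (N + e *\<^sub>R mat 1)"
    using psd_inner_pos_def_nonneg[OF assms(1)] by (auto simp: eventually_at_right_less
        intro: eventually_mono[OF eventually_at_right_less])
qed simp

text \<open>Testing the form on e_i + e_j and e_i - e_j bounds each entry by the mean of two
  diagonal entries. Summing over all entries produces the square of the dimension.\<close>

lemma psd_norm_le_trace:
  fixes M :: "real^'n^'n"
  assumes "psd M"
  shows "norm M \<le> (real CARD('n))\<^sup>2 * trace M"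
proof -
  have form: "0 \<le> v \<bullet> (M *v v)" for v
    using assms by (simp add: psd_def)
  have entry: "axis i 1 \<bullet> (M *v axis j 1) = M $ i $ j" for i j
    by (simp add: inner_axis' matrix_vector_mult_basis column_def)
  have diag: "0 \<le> M $ i $ i" for i
    using form[of "axis i 1"] by (simp add: entry)
  have le_trace: "M $ i $ i \<le> trace M" for i
    unfolding trace_def by (rule member_le_sum) (auto simp: diag)
  have "\<bar>M $ i $ j\<bar> \<le> trace M" for i j
  proof -
    have "transpose M $ i $ j = M $ i $ j"
      using assms by (simp add: psd_def)
    then have sym: "M $ j $ i = M $ i $ j"
      by (simp add: transpose_def)
    have "0 \<le> M $ i $ i + 2 * M $ i $ j + M $ j $ j"
      using form[of "axis i 1 + axis j 1"]
      by (simp add: matrix_vector_right_distrib inner_add_left inner_add_right entry sym)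
    moreover have "0 \<le> M $ i $ i - 2 * M $ i $ j + M $ j $ j"
      using form[of "axis i 1 - axis j 1"]
      by (simp add: matrix_vector_mult_diff_distrib inner_diff_left inner_diff_right entry sym)
    ultimately show ?thesis
      using le_trace[of i] le_trace[of j] by linarith
  qed
  then have "(\<Sum>i\<in>UNIV. \<Sum>j\<in>UNIV. \<bar>M $ i $ j\<bar>) \<le> (\<Sum>i\<in>(UNIV::'n set). \<Sum>j\<in>(UNIV::'n set). trace M)"
    by (intro sum_mono)
  moreover have "norm M \<le> (\<Sum>i\<in>UNIV. norm (M $ i))"
    by (simp add: norm_vec_def L2_set_le_sum)
  moreover have "\<dots> \<le> (\<Sum>i\<in>UNIV. \<Sum>j\<in>UNIV. \<bar>M $ i $ j\<bar>)"
    by (intro sum_mono norm_le_l1_cart)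
  ultimately show ?thesis
    by (simp add: power2_eq_square)
qed

text \<open>M - a I is psd for the coercivity constant a, so M . N is at least a times the trace of
  N, which controls the norm of N. This is what makes the multiplier \<Lambda> bounded.\<close>

lemma pos_def_inner_coercive:
  fixes M :: "real^'n^'n"
  assumes "pos_def M"
  obtains a where "0 < a" "\<And>N. psd N \<Longrightarrow> a * norm N \<le> M \<bullet> N"
proof -
  obtain a where a: "0 < a" "\<And>v. a * (norm v)\<^sup>2 \<le> v \<bullet> (M *v v)"
    using pos_def_coercive[OF assms] by blast
  let ?n = "(real CARD('n))\<^sup>2"
  have "a / ?n * norm N \<le> M \<bullet> N" if N: "psd N" for N
  proof -
    have "psd (M - a *\<^sub>R mat 1)"
      using a(2) pos_def_imp_psd[OF assms]
      by (auto simp: psd_def transpose_eq_inner matrix_vector_mult_diff_rdistrib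
          inner_diff_left inner_diff_right power2_norm_eq_inner
          simp flip: scaleR_matrix_vector_assoc)
    from psd_inner_nonneg[OF this N] have "a * (mat 1 \<bullet> N) \<le> M \<bullet> N"
      by (simp add: inner_diff_left)
    also have "mat 1 \<bullet> N = trace N"
      by (simp add: inner_vec_def mat_def trace_def if_distrib[of "\<lambda>x. x * _"] cong: if_cong)
    finally have "a * trace N \<le> M \<bullet> N" .
    moreover have "a * norm N \<le> a * (?n * trace N)"
      using a(1) by (intro mult_left_mono psd_norm_le_trace N) auto
    ultimately have "a * norm N \<le> ?n * (M \<bullet> N)"
      by (smt (verit, ccfv_threshold) mult.left_commute mult_left_mono zero_le_power2)
    then show ?thesis
      by (simp add: field_simps)
  qed
  moreover have "a / ?n > 0"
    using a(1) by simp
  ultimately show thesis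
    using that by blast
qed

section \<open>Moments of measures on a compact set\<close>

lemma integrable_borel_prob_measures:
  fixes f :: "'a::topological_space \<Rightarrow> 'b::{banach,second_countable_topology}"
  assumes "P \<in> borel_prob_measures \<Xi>" "compact \<Xi>" "continuous_on \<Xi> f"
  shows "integrable P f"
proof -
  have sets: "sets P = sets (restrict_space borel \<Xi>)" and "prob_space P"
    using assms(1) by (auto simp: borel_prob_measures_def)
  then interpret prob_space P
    by simp
  have space: "space P = \<Xi>"
    using sets_eq_imp_space_eq[OF sets] by (simp add: space_restrict_space)
  have "bounded (f ` \<Xi>)"
    by (intro compact_imp_bounded compact_continuous_image assms)
  then obtain B where "\<And>\<xi>. \<xi> \<in> \<Xi> \<Longrightarrow> norm (f \<xi>) \<le> B"
    by (auto simp: bounded_iff)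
  moreover have "f \<in> borel_measurable P"
    using borel_measurable_continuous_on_restrict[OF assms(3)] measurable_cong_sets[OF sets refl]
    by blast
  ultimately show ?thesis
    by (intro integrable_const_bound[where B = B]) (auto simp: space)
qed

text \<open>Turns a convex combination of points of \<Xi> into a measure. The weights sit on the
  indices and are pushed forward, so repetitions among the points \<open>z i\<close> are
  harmless.\<close>

lemma finite_support_borel_prob_measure:
  fixes z :: "nat \<Rightarrow> 'a::topological_space"
  assumes "\<And>i. i \<in> {1..n} \<Longrightarrow> 0 \<le> u i" "\<And>i. i \<in> {1..n} \<Longrightarrow> z i \<in> \<Xi>" "sum u {1..n} = 1"
  obtains P where "P \<in> borel_prob_measures \<Xi>"
    and "\<And>f :: 'a \<Rightarrow> real. continuous_on \<Xi> f \<Longrightarrow> (LINT \<xi>|P. f \<xi>) = (\<Sum>i=1..n. u i * f (z i))"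
proof -
  let ?u = "\<lambda>i. if i \<in> {1..n} then u i else 0"
  define p where "p = embed_pmf ?u"
  have "(\<integral>\<^sup>+i. ennreal (?u i) \<partial>count_space UNIV) = (\<Sum>i\<in>{1..n}. ennreal (?u i))"
    by (rule nn_integral_count_space') auto
  also have "\<dots> = (\<Sum>i\<in>{1..n}. ennreal (u i))"
    by (intro sum.cong) auto
  also have "\<dots> = ennreal (sum u {1..n})"
    using assms(1) by (rule sum_ennreal)
  also have "\<dots> = 1"
    using assms(3) by simp
  finally have p: "pmf p i = ?u i" for i
    unfolding p_def by (subst pmf_embed_pmf) (auto simp: assms(1))
  have "n \<ge> 1"
    using assms(3) by (cases n) auto
  \<comment> \<open>Indices outside the range have weight 0; sending them to \<open>z 1\<close>
    makes Z map everything into \<Xi>, as measurability requires.\<close>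
  define Z where "Z i = (if i \<in> {1..n} then z i else z 1)" for i
  have Z: "Z \<in> measurable (measure_pmf p) (restrict_space borel \<Xi>)"
    using assms(2) \<open>n \<ge> 1\<close> by (auto simp: Z_def space_restrict_space)
  define P where "P = distr (measure_pmf p) (restrict_space borel \<Xi>) Z"
  have "P \<in> borel_prob_measures \<Xi>"
    using measure_pmf.prob_space_distr[OF Z] by (simp add: borel_prob_measures_def P_def)
  moreover have "(LINT \<xi>|P. f \<xi>) = (\<Sum>i=1..n. u i * f (z i))"
    if "continuous_on \<Xi> f" for f :: "'a \<Rightarrow> real"
  proof -
    have "(LINT \<xi>|P. f \<xi>) = (LINT i|measure_pmf p. f (Z i))"
      unfolding P_def by (intro integral_distr Z borel_measurable_continuous_on_restrict that)
    also have "\<dots> = (\<Sum>i\<in>{1..n}. f (Z i) * pmf p i)"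
      by (rule integral_measure_pmf_real) (auto simp: set_pmf_eq p split: if_splits)
    also have "\<dots> = (\<Sum>i=1..n. u i * f (z i))"
      by (intro sum.cong) (auto simp: p Z_def)
    finally show ?thesis .
  qed
  ultimately show thesis
    using that by blast
qed

section \<open>Matrix inequalities between expectations as families of scalar inequalities\<close>

lemma bounded_linear_quadratic_form: "bounded_linear (\<lambda>M :: real^'n^'n. v \<bullet> (M *v w))"
  unfolding inner_outer[symmetric] by (rule bounded_linear_inner_left)

lemma bounded_linear_transpose: "bounded_linear (transpose :: real^'n^'n \<Rightarrow> real^'n^'n)"
  unfolding linear_conv_bounded_linear[symmetric]
  by (rule linearI) (simp_all add: transpose_def vec_eq_iff)

lemma transpose_zero: "transpose 0 = 0"
  by (simp add: transpose_def vec_eq_iff)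

lemma loewner_le_integral_iff:
  fixes F :: "'a \<Rightarrow> real^'n^'n" and N :: "real^'n^'n"
  assumes "integrable P F" "\<And>\<xi>. transpose (F \<xi>) = F \<xi>" "transpose N = N"
  shows "(LINT \<xi>|P. F \<xi>) \<preceq>\<^sub>L N \<longleftrightarrow> (\<forall>v. (LINT \<xi>|P. v \<bullet> (F \<xi> *v v)) \<le> v \<bullet> (N *v v))"
proof -
  have "transpose (LINT \<xi>|P. F \<xi>) = (LINT \<xi>|P. F \<xi>)"
    using integral_bounded_linear[OF bounded_linear_transpose assms(1)] unfolding assms(2)
    by (rule sym)
  then have "transpose (N - (LINT \<xi>|P. F \<xi>)) = N - (LINT \<xi>|P. F \<xi>)"
    by (simp add: linear_diff[OF bounded_linear.linear[OF bounded_linear_transpose]] assms(3))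
  moreover have "(LINT \<xi>|P. v \<bullet> (F \<xi> *v v)) = v \<bullet> ((LINT \<xi>|P. F \<xi>) *v v)" for v
    by (rule integral_bounded_linear[OF bounded_linear_quadratic_form assms(1)])
  ultimately show ?thesis
    by (simp add: loewner_le_def psd_def matrix_vector_mult_diff_rdistrib inner_diff_right)
qed

lemma continuous_on_outer [continuous_intros]:
  assumes "continuous_on A f" "continuous_on A g"
  shows "continuous_on A (\<lambda>x. outer (f x) (g x))"
  unfolding outer_def by (intro continuous_intros assms)

lemma continuous_on_moment_block:
  fixes \<mu> :: "real^'n::finite"
  shows "continuous_on A (moment_block \<mu> \<Sigma> \<kappa>1)"
  unfolding moment_block_def
proof (intro continuous_on_vec_lambda)
  fix i j :: "'n option"
  show "continuous_on A (\<lambda>\<xi>. case i of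
      Some k \<Rightarrow> (case j of Some l \<Rightarrow> - (\<Sigma> $ k $ l) | None \<Rightarrow> (\<mu> - \<xi>) $ k)
    | None \<Rightarrow> (case j of Some l \<Rightarrow> (\<mu> - \<xi>) $ l | None \<Rightarrow> - \<kappa>1))"
    by (cases i; cases j) (auto intro!: continuous_intros)
qed

lemma transpose_outer_self [simp]: "transpose (outer v v) = outer v v"
  by (simp add: transpose_def outer_def vec_eq_iff mult.commute)

lemma transpose_moment_block:
  "transpose \<Sigma> = \<Sigma> \<Longrightarrow> transpose (moment_block \<mu> \<Sigma> \<kappa>1 \<xi>) = moment_block \<mu> \<Sigma> \<kappa>1 \<xi>"
  by (auto simp: transpose_def moment_block_def vec_eq_iff split: option.split)

lemma moment_block_quadratic_form:
  fixes v :: "real^('n::finite option)"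
  defines "w \<equiv> (\<chi> i. v $ Some i)" and "s \<equiv> v $ None"
  shows "v \<bullet> (moment_block \<mu> \<Sigma> \<kappa>1 \<xi> *v v) =
    - (w \<bullet> (\<Sigma> *v w)) - 2 * s * (w \<bullet> (\<xi> - \<mu>)) - \<kappa>1 * s\<^sup>2"
proof -
  have sum_option: "(\<Sum>i\<in>UNIV. g i) = g None + (\<Sum>i\<in>UNIV. g (Some i))" for g :: "'n option \<Rightarrow> real"
    by (simp add: UNIV_option_conv sum.reindex)
  show ?thesis
    by (simp add: inner_vec_def matrix_vector_mult_def sum_option moment_block_def w_def s_def
        sum_distrib_left sum.distrib sum_subtractf sum_negf algebra_simps power2_eq_square)
qed

text \<open>A Schur complement: the test vector of the block matrix is an arbitrary pair (w, s), and
  with m w the mean of w . (\<xi> - \<mu>) the condition is w . \<Sigma> w + 2 s (m w) + \<kappa>1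
  s^2 >= 0. Minimising over s, at s = - m w / \<kappa>1, leaves (m w)^2 <= \<kappa>1 (w . \<Sigma>
  w).\<close>

lemma primal_feasible_iff:
  fixes \<Sigma> :: "real^'n^'n"
  assumes "compact \<Xi>" "pos_def \<Sigma>" "\<kappa>1 > 0"
  shows "P \<in> primal_feasible \<Xi> \<mu> \<Sigma> \<kappa>1 \<kappa>2 \<longleftrightarrow> P \<in> borel_prob_measures \<Xi> \<and>
    (\<forall>v. (LINT \<xi>|P. v \<bullet> (\<xi> - \<mu>)) \<le> sqrt (\<kappa>1 * (v \<bullet> (\<Sigma> *v v)))) \<and>
    (\<forall>v. (LINT \<xi>|P. (v \<bullet> (\<xi> - \<mu>))\<^sup>2) \<le> \<kappa>2 * (v \<bullet> (\<Sigma> *v v)))"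
proof (cases "P \<in> borel_prob_measures \<Xi>")
  case P: True
  then interpret prob_space P
    by (simp add: borel_prob_measures_def)
  have sym: "transpose \<Sigma> = \<Sigma>"
    using assms(2) by (simp add: pos_def_def)
  have form: "0 \<le> v \<bullet> (\<Sigma> *v v)" for v
    using pos_def_imp_psd[OF assms(2)] by (simp add: psd_def)
  note intg = integrable_borel_prob_measures[OF P assms(1)]
  define m where "m v = (LINT \<xi>|P. v \<bullet> (\<xi> - \<mu>))" for v
  have intm: "integrable P (\<lambda>\<xi>. v \<bullet> (\<xi> - \<mu>))" for v
    by (intro intg continuous_intros)
  have block: "(LINT \<xi>|P. v \<bullet> (moment_block \<mu> \<Sigma> \<kappa>1 \<xi> *v v)) =
    - ((\<chi> i. v $ Some i) \<bullet> (\<Sigma> *v (\<chi> i. v $ Some i))) - 2 * (v $ None) * m (\<chi> i. v $ Some i)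
    - \<kappa>1 * (v $ None)\<^sup>2" for v
    unfolding moment_block_quadratic_form
    by (simp add: intm prob_space m_def)
  have "integrable P (moment_block \<mu> \<Sigma> \<kappa>1)"
    by (intro intg continuous_on_moment_block)
  then have "(LINT \<xi>|P. moment_block \<mu> \<Sigma> \<kappa>1 \<xi>) \<preceq>\<^sub>L 0 \<longleftrightarrow>
    (\<forall>v. (LINT \<xi>|P. v \<bullet> (moment_block \<mu> \<Sigma> \<kappa>1 \<xi> *v v)) \<le> 0)"
    by (subst loewner_le_integral_iff)
      (simp_all add: transpose_moment_block[OF sym] transpose_zero)
  also have "\<dots> \<longleftrightarrow> (\<forall>v. 0 \<le> (\<chi> i. v $ Some i) \<bullet> (\<Sigma> *v (\<chi> i. v $ Some i))
      + 2 * (v $ None) * m (\<chi> i. v $ Some i) + \<kappa>1 * (v $ None)\<^sup>2)"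
    unfolding block by (intro all_cong1 iffI) linarith+
  also have "\<dots> \<longleftrightarrow> (\<forall>w s. 0 \<le> w \<bullet> (\<Sigma> *v w) + 2 * s * m w + \<kappa>1 * s\<^sup>2)"
  proof safe
    fix w s
    assume *: "\<forall>v. 0 \<le> (\<chi> i. v $ Some i) \<bullet> (\<Sigma> *v (\<chi> i. v $ Some i))
      + 2 * (v $ None) * m (\<chi> i. v $ Some i) + \<kappa>1 * (v $ None)\<^sup>2"
    show "0 \<le> w \<bullet> (\<Sigma> *v w) + 2 * s * m w + \<kappa>1 * s\<^sup>2"
      using *[rule_format, of "\<chi> i. case i of None \<Rightarrow> s | Some j \<Rightarrow> w $ j"] by simp
  qed blast
  also have "\<dots> \<longleftrightarrow> (\<forall>w. (m w)\<^sup>2 \<le> \<kappa>1 * (w \<bullet> (\<Sigma> *v w)))"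
  proof (intro iffI allI)
    fix w s
    assume *: "\<forall>w. (m w)\<^sup>2 \<le> \<kappa>1 * (w \<bullet> (\<Sigma> *v w))"
    have "\<kappa>1 * (w \<bullet> (\<Sigma> *v w) + 2 * s * m w + \<kappa>1 * s\<^sup>2) =
      (\<kappa>1 * s + m w)\<^sup>2 + (\<kappa>1 * (w \<bullet> (\<Sigma> *v w)) - (m w)\<^sup>2)"
      by (simp add: power2_eq_square algebra_simps)
    also have "\<dots> \<ge> 0"
      using * by simp
    finally show "0 \<le> w \<bullet> (\<Sigma> *v w) + 2 * s * m w + \<kappa>1 * s\<^sup>2"
      using assms(3) by (simp add: zero_le_mult_iff)
  next
    fix w
    assume "\<forall>w s. 0 \<le> w \<bullet> (\<Sigma> *v w) + 2 * s * m w + \<kappa>1 * s\<^sup>2"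
    then have "0 \<le> w \<bullet> (\<Sigma> *v w) + 2 * (- m w / \<kappa>1) * m w + \<kappa>1 * (- m w / \<kappa>1)\<^sup>2"
      by blast
    then show "(m w)\<^sup>2 \<le> \<kappa>1 * (w \<bullet> (\<Sigma> *v w))"
      using assms(3) by (simp add: field_simps power2_eq_square)
  qed
  also have "\<dots> \<longleftrightarrow> (\<forall>w. m w \<le> sqrt (\<kappa>1 * (w \<bullet> (\<Sigma> *v w))))"
  proof (intro iffI allI)
    fix w
    assume "\<forall>w. (m w)\<^sup>2 \<le> \<kappa>1 * (w \<bullet> (\<Sigma> *v w))"
    then show "m w \<le> sqrt (\<kappa>1 * (w \<bullet> (\<Sigma> *v w)))"
      by (blast intro: real_le_rsqrt)
  next
    fix w
    assume *: "\<forall>w. m w \<le> sqrt (\<kappa>1 * (w \<bullet> (\<Sigma> *v w)))"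
    \<comment> \<open>Since m is odd, the one-sided bound for all w already bounds the absolute
      value.\<close>
    have "m (- w) = - m w"
      by (simp add: m_def flip: integral_minus)
    then have "\<bar>m w\<bar> \<le> sqrt (\<kappa>1 * (w \<bullet> (\<Sigma> *v w)))"
      using *[rule_format, of w] *[rule_format, of "- w"]
      by (simp add: linear_neg[OF matrix_vector_mul_linear] abs_le_iff)
    then have "\<bar>m w\<bar>\<^sup>2 \<le> (sqrt (\<kappa>1 * (w \<bullet> (\<Sigma> *v w))))\<^sup>2"
      by (rule power_mono) simp
    then show "(m w)\<^sup>2 \<le> \<kappa>1 * (w \<bullet> (\<Sigma> *v w))"
      using assms(3) form[of w] by simp
  qed
  finally have 1: "(LINT \<xi>|P. moment_block \<mu> \<Sigma> \<kappa>1 \<xi>) \<preceq>\<^sub>L 0 \<longleftrightarrow>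
    (\<forall>w. m w \<le> sqrt (\<kappa>1 * (w \<bullet> (\<Sigma> *v w))))" .
  have "integrable P (\<lambda>\<xi>. outer (\<xi> - \<mu>) (\<xi> - \<mu>))"
    by (intro intg continuous_intros)
  then have 2: "(LINT \<xi>|P. outer (\<xi> - \<mu>) (\<xi> - \<mu>)) \<preceq>\<^sub>L \<kappa>2 *\<^sub>R \<Sigma> \<longleftrightarrow>
    (\<forall>v. (LINT \<xi>|P. (v \<bullet> (\<xi> - \<mu>))\<^sup>2) \<le> \<kappa>2 * (v \<bullet> (\<Sigma> *v v)))"
    by (subst loewner_le_integral_iff)
      (simp_all add: transpose_scalar sym outer_mult_vec power2_eq_square inner_commute
        flip: scaleR_matrix_vector_assoc)
  show ?thesis
    by (simp add: primal_feasible_def P 1 2 prob_space m_def)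
qed (simp add: primal_feasible_def)

section \<open>Duality\<close>

lemma bounded_linear_matrix_vector_left: "bounded_linear (\<lambda>M :: real^'n^'m. M *v v)"
  unfolding linear_conv_bounded_linear[symmetric]
  by (rule linearI) (simp_all add: matrix_vector_mult_add_rdistrib scaleR_matrix_vector_assoc)

text \<open>The exact second-order Taylor expansion at \<mu>; by symmetry of \<Lambda> the gradient
  there is q + 2 \<Lambda> \<mu>.\<close>

lemma psd_quadratic_shift:
  assumes "psd \<Lambda>"
  shows "(\<Lambda> *v \<xi> + q) \<bullet> \<xi> = (\<Lambda> *v \<mu> + q) \<bullet> \<mu> + (q + 2 *\<^sub>R (\<Lambda> *v \<mu>)) \<bullet> (\<xi> - \<mu>)
    + (\<xi> - \<mu>) \<bullet> (\<Lambda> *v (\<xi> - \<mu>))"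
proof -
  have "(\<Lambda> *v \<xi>) \<bullet> \<mu> = (\<Lambda> *v \<mu>) \<bullet> \<xi>" "\<xi> \<bullet> (\<Lambda> *v \<mu>) = (\<Lambda> *v \<mu>) \<bullet> \<xi>"
    "\<mu> \<bullet> (\<Lambda> *v \<xi>) = (\<Lambda> *v \<mu>) \<bullet> \<xi>" "\<mu> \<bullet> (\<Lambda> *v \<mu>) = (\<Lambda> *v \<mu>) \<bullet> \<mu>" "\<xi> \<bullet> (\<Lambda> *v \<xi>) = (\<Lambda> *v \<xi>) \<bullet> \<xi>"
    using psd_inner_commute[OF assms] by (metis inner_commute)+
  then show ?thesis
    by (simp add: matrix_vector_mult_diff_distrib inner_add_left inner_diff_left
        inner_diff_right algebra_simps)
qed

text \<open>Taking \<open>q + 2 \<Lambda> \<mu>\<close> as dual variable instead of \<open>q\<close> centres the problem at \<open>\<mu>\<close>, see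
  \<open>psd_quadratic_shift\<close>; \<open>k\<close> is the objective up to an additive constant.\<close>

lemma weak_duality:
  fixes \<Sigma> \<Lambda> :: "real^'n^'n"
  assumes "compact \<Xi>" "pos_def \<Sigma>" "\<kappa>1 > 0" "continuous_on \<Xi> k"
    and P: "P \<in> primal_feasible \<Xi> \<mu> \<Sigma> \<kappa>1 \<kappa>2"
    and "psd \<Lambda>" and le: "\<And>\<xi>. \<xi> \<in> \<Xi> \<Longrightarrow> k \<xi> \<le> r + (\<Lambda> *v \<xi> + q) \<bullet> \<xi>"
  defines "b \<equiv> q + 2 *\<^sub>R (\<Lambda> *v \<mu>)"
  shows "(LINT \<xi>|P. k \<xi>) \<le> r + \<kappa>2 * (\<Sigma> \<bullet> \<Lambda>) + (\<Lambda> *v \<mu> + q) \<bullet> \<mu> + sqrt (\<kappa>1 * (b \<bullet> (\<Sigma> *v b)))"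
proof -
  have PB: "P \<in> borel_prob_measures \<Xi>"
    using P by (simp add: primal_feasible_def)
  then interpret prob_space P
    by (simp add: borel_prob_measures_def)
  have space: "space P = \<Xi>"
    using PB sets_eq_imp_space_eq[of P "restrict_space borel \<Xi>"]
    by (auto simp: borel_prob_measures_def space_restrict_space)
  note intg = integrable_borel_prob_measures[OF PB assms(1)]
  let ?O = "\<lambda>\<xi>. outer (\<xi> - \<mu>) (\<xi> - \<mu>)"
  let ?c = "r + (\<Lambda> *v \<mu> + q) \<bullet> \<mu>"
  have O: "integrable P ?O" and B: "integrable P (\<lambda>\<xi>. b \<bullet> (\<xi> - \<mu>))"
    by (intro intg continuous_intros)+
  have "(LINT \<xi>|P. k \<xi>) \<le> (LINT \<xi>|P. ?c + b \<bullet> (\<xi> - \<mu>) + \<Lambda> \<bullet> ?O \<xi>)"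
  proof (rule integral_mono)
    fix \<xi> assume "\<xi> \<in> space P"
    then show "k \<xi> \<le> ?c + b \<bullet> (\<xi> - \<mu>) + \<Lambda> \<bullet> ?O \<xi>"
      using le[of \<xi>] psd_quadratic_shift[OF \<open>psd \<Lambda>\<close>, of \<xi> q \<mu>]
      by (simp add: space b_def inner_outer)
  qed (intro intg continuous_intros assms)+
  also have "\<dots> = ?c + (LINT \<xi>|P. b \<bullet> (\<xi> - \<mu>)) + \<Lambda> \<bullet> (LINT \<xi>|P. ?O \<xi>)"
    using O B by (simp add: prob_space)
  \<comment> \<open>Each remaining term is paired with one constraint: b with the bound on the mean,
    \<Lambda> with the bound on the second moment.\<close>
  also have "(LINT \<xi>|P. b \<bullet> (\<xi> - \<mu>)) \<le> sqrt (\<kappa>1 * (b \<bullet> (\<Sigma> *v b)))"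
    using P primal_feasible_iff[OF assms(1,2,3)] by blast
  also have "\<Lambda> \<bullet> (LINT \<xi>|P. ?O \<xi>) \<le> \<kappa>2 * (\<Sigma> \<bullet> \<Lambda>)"
  proof -
    have "psd (\<kappa>2 *\<^sub>R \<Sigma> - (LINT \<xi>|P. ?O \<xi>))"
      using P by (simp add: primal_feasible_def loewner_le_def)
    from psd_inner_nonneg[OF this \<open>psd \<Lambda>\<close>] show ?thesis
      by (simp add: inner_diff_left inner_diff_right inner_commute)
  qed
  finally show ?thesis
    by simp
qed

text \<open>Used along recession directions of the separated set, where a negative slope would
  eventually undercut any lower bound.\<close>

lemma ray_bounded_below:
  fixes c d e :: real
  assumes "\<And>s. 0 \<le> s \<Longrightarrow> c \<le> d + s * e"
  shows "0 \<le> e"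
proof (rule ccontr)
  assume "\<not> 0 \<le> e"
  then have e: "e < 0"
    by simp
  define s where "s = (\<bar>d - c\<bar> + 1) / - e"
  have "s \<ge> 0" "s * e = - (\<bar>d - c\<bar> + 1)"
    using e by (auto simp: s_def field_simps)
  then show False
    using assms[of s] by linarith
qed

lemma psd_scaleR: "psd M \<Longrightarrow> 0 \<le> c \<Longrightarrow> psd (c *\<^sub>R M)"
  by (simp add: psd_def transpose_scalar flip: scaleR_matrix_vector_assoc)

lemma inner_outer_outer: "outer v v \<bullet> outer w w = (v \<bullet> w)\<^sup>2"
  by (simp add: inner_outer outer_mult_vec power2_eq_square inner_commute[of w v])

text \<open>The convex hull of the moment curve \<open>(k \<xi>, \<xi> - \<mu>, (\<xi> - \<mu>)(\<xi> - \<mu>)\<^sup>T)\<close> is separated from the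
  set of moments that would be feasible with a value above \<open>V\<close>. The separating functional is, up
  to scaling, a dual solution. In the second set the matrix is not required to be symmetric, so
  that the set has interior points and the functional cannot vanish on the first component.\<close>

lemma strong_duality:
  fixes \<Sigma> :: "real^'n^'n" and \<mu> :: "real^'n"
  assumes "compact \<Xi>" "pos_def \<Sigma>" "\<kappa>1 > 0" "\<kappa>2 > 0" "continuous_on \<Xi> k" "\<mu> \<in> \<Xi>"
    and V: "\<And>P. P \<in> primal_feasible \<Xi> \<mu> \<Sigma> \<kappa>1 \<kappa>2 \<Longrightarrow> (LINT \<xi>|P. k \<xi>) \<le> V"
  obtains r q \<Lambda> where "psd \<Lambda>" "\<forall>\<xi>\<in>\<Xi>. k \<xi> \<le> r + (\<Lambda> *v \<xi> + q) \<bullet> \<xi>"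
    "r + \<kappa>2 * (\<Sigma> \<bullet> \<Lambda>) + (\<Lambda> *v \<mu> + q) \<bullet> \<mu>
      + sqrt (\<kappa>1 * ((q + 2 *\<^sub>R (\<Lambda> *v \<mu>)) \<bullet> (\<Sigma> *v (q + 2 *\<^sub>R (\<Lambda> *v \<mu>))))) \<le> V"
proof -
  have form: "0 \<le> v \<bullet> (\<Sigma> *v v)" for v
    using pos_def_imp_psd[OF assms(2)] by (simp add: psd_def)
  define f where "f \<xi> = (k \<xi>, \<xi> - \<mu>, outer (\<xi> - \<mu>) (\<xi> - \<mu>))" for \<xi>
  \<comment> \<open>E is the ellipsoid of admissible mean deviations, given by its support function;
    F collects the admissible second moments. As intersections of half-spaces both are convex at
    once.\<close>
  define E where "E = (\<Inter>v. {u. v \<bullet> u \<le> sqrt (\<kappa>1 * (v \<bullet> (\<Sigma> *v v)))})"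
  define F where "F = (\<Inter>v. {U. outer v v \<bullet> U \<le> \<kappa>2 * (v \<bullet> (\<Sigma> *v v))})"
  define T where "T = {V<..} \<times> E \<times> F"
  have quad: "outer v v \<bullet> U = v \<bullet> (U *v v)" for v :: "real^'n" and U
    by (simp add: inner_outer[symmetric] inner_commute)
  have zero_E: "0 \<in> E" and zero_F: "0 \<in> F" and \<Sigma>_F: "\<kappa>2 *\<^sub>R \<Sigma> \<in> F"
    using form assms(3,4)
    by (auto simp: E_def F_def quad simp flip: scaleR_matrix_vector_assoc)
  have "convex T"
    unfolding T_def E_def F_def
    by (intro convex_Times convex_INT convex_halfspace_le convex_real_interval)
  moreover have "(V + 1, 0, 0) \<in> T"
    using zero_E zero_F by (simp add: T_def)
  then have "T \<noteq> {}"
    by blast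
  moreover have "(convex hull (f ` \<Xi>)) \<inter> T = {}"
  proof (rule ccontr)
    \<comment> \<open>A common point is the moment vector of a finitely supported measure, which
      would be primal feasible with a value above V.\<close>
    assume "(convex hull (f ` \<Xi>)) \<inter> T \<noteq> {}"
    then obtain w where "w \<in> convex hull (f ` \<Xi>)" and w: "w \<in> T"
      by blast
    then obtain n u y where y: "\<forall>i\<in>{1..n::nat}. 0 \<le> u i \<and> y i \<in> f ` \<Xi>"
      and sum: "sum u {1..n} = 1" and "(\<Sum>i=1..n. u i *\<^sub>R y i) = w"
      unfolding convex_hull_indexed mem_Collect_eq by (elim exE conjE)
    with w have T: "(\<Sum>i=1..n. u i *\<^sub>R y i) \<in> T"
      by simp
    from y have "\<forall>i\<in>{1..n}. \<exists>w. w \<in> \<Xi> \<and> y i = f w"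
      by blast
    from bchoice[OF this] obtain z where z: "\<And>i. i \<in> {1..n} \<Longrightarrow> z i \<in> \<Xi> \<and> y i = f (z i)"
      by blast
    obtain P where P: "P \<in> borel_prob_measures \<Xi>"
      and intP: "\<And>g :: real^'n \<Rightarrow> real. continuous_on \<Xi> g \<Longrightarrow>
        (LINT \<xi>|P. g \<xi>) = (\<Sum>i=1..n. u i * g (z i))"
      using finite_support_borel_prob_measure[of n u z \<Xi>] y z sum by blast
    have "(\<Sum>i=1..n. u i *\<^sub>R y i) = (\<Sum>i=1..n. u i *\<^sub>R f (z i))"
      using z by (intro sum.cong) auto
    with T have mem: "(\<Sum>i=1..n. u i *\<^sub>R f (z i)) \<in> T"
      by simp
    have "(\<Sum>i=1..n. u i *\<^sub>R f (z i)) = (\<Sum>i=1..n. u i * k (z i),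
        \<Sum>i=1..n. u i *\<^sub>R (z i - \<mu>), \<Sum>i=1..n. u i *\<^sub>R outer (z i - \<mu>) (z i - \<mu>))"
      by (simp add: f_def prod_eq_iff fst_sum snd_sum)
    with mem have gt: "V < (\<Sum>i=1..n. u i * k (z i))"
      and E: "(\<Sum>i=1..n. u i *\<^sub>R (z i - \<mu>)) \<in> E"
      and F: "(\<Sum>i=1..n. u i *\<^sub>R outer (z i - \<mu>) (z i - \<mu>)) \<in> F"
      by (auto simp: T_def)
    have "(LINT \<xi>|P. v \<bullet> (\<xi> - \<mu>)) \<le> sqrt (\<kappa>1 * (v \<bullet> (\<Sigma> *v v)))" for v
    proof -
      have "(LINT \<xi>|P. v \<bullet> (\<xi> - \<mu>)) = v \<bullet> (\<Sum>i=1..n. u i *\<^sub>R (z i - \<mu>))"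
        by (subst intP) (auto intro!: continuous_intros simp: inner_sum_right)
      then show ?thesis
        using E by (simp add: E_def)
    qed
    moreover have "(LINT \<xi>|P. (v \<bullet> (\<xi> - \<mu>))\<^sup>2) \<le> \<kappa>2 * (v \<bullet> (\<Sigma> *v v))" for v
    proof -
      have "(LINT \<xi>|P. (v \<bullet> (\<xi> - \<mu>))\<^sup>2)
          = outer v v \<bullet> (\<Sum>i=1..n. u i *\<^sub>R outer (z i - \<mu>) (z i - \<mu>))"
        by (subst intP) (auto intro!: continuous_intros simp: inner_sum_right inner_outer_outer)
      then show ?thesis
        using F by (simp add: F_def)
    qed
    ultimately have "P \<in> primal_feasible \<Xi> \<mu> \<Sigma> \<kappa>1 \<kappa>2"
      using P by (simp add: primal_feasible_iff[OF assms(1,2,3)])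
    from V[OF this] gt show False
      by (simp add: intP[OF assms(5)])
  qed
  moreover have "convex hull (f ` \<Xi>) \<noteq> {}"
    using assms(6) by auto
  ultimately obtain h c where "h \<noteq> 0" and hull: "\<And>y. y \<in> convex hull (f ` \<Xi>) \<Longrightarrow> h \<bullet> y \<le> c"
    and above: "\<And>y. y \<in> T \<Longrightarrow> c \<le> h \<bullet> y"
    using separating_hyperplane_sets[OF convex_convex_hull, of T "f ` \<Xi>"] by blast
  obtain a b C where h: "h = (a, b, C)"
    by (cases h)
  have below: "a * k \<xi> + b \<bullet> (\<xi> - \<mu>) + (\<xi> - \<mu>) \<bullet> (C *v (\<xi> - \<mu>)) \<le> c" if "\<xi> \<in> \<Xi>" for \<xi>
    using hull[OF hull_inc[OF imageI[OF that]]] by (simp add: h f_def inner_outer)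
  have above: "c \<le> a * t + b \<bullet> u + C \<bullet> U" if "V < t" "u \<in> E" "U \<in> F" for t u U
    using above[of "(t, u, U)"] that by (simp add: h T_def)
  \<comment> \<open>The first coordinate of T is unbounded above.\<close>
  have "0 \<le> a"
  proof (rule ray_bounded_below)
    fix s :: real assume "0 \<le> s"
    then show "c \<le> a * (V + 1) + s * a"
      using above[of "V + 1 + s" 0 0] zero_E zero_F by (simp add: algebra_simps)
  qed
  \<comment> \<open>Matrices with nonpositive form are recession directions of F.\<close>
  have neg: "0 \<le> C \<bullet> U" if "\<And>v. v \<bullet> (U *v v) \<le> 0" for U
  proof (rule ray_bounded_below)
    fix s :: real assume "0 \<le> s"
    have "v \<bullet> ((s *\<^sub>R U) *v v) \<le> \<kappa>2 * (v \<bullet> (\<Sigma> *v v))" for v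
    proof -
      have "s * (v \<bullet> (U *v v)) \<le> 0"
        using \<open>0 \<le> s\<close> that by (rule mult_nonneg_nonpos)
      also have "0 \<le> \<kappa>2 * (v \<bullet> (\<Sigma> *v v))"
        using assms(4) form by simp
      finally show ?thesis
        by (simp flip: scaleR_matrix_vector_assoc)
    qed
    then have "s *\<^sub>R U \<in> F"
      by (simp add: F_def quad)
    then show "c \<le> a * (V + 1) + s * (C \<bullet> U)"
      using above[of "V + 1" 0 "s *\<^sub>R U"] zero_E by simp
  qed
  have inner_transpose: "C \<bullet> transpose C = transpose C \<bullet> C"
    by (rule inner_commute)
  \<comment> \<open>An antisymmetric matrix has zero form, so it and its negative are both recession
    directions and C is orthogonal to it. Taking the antisymmetric part of C itself shows that this
    part is 0.\<close>
  have "transpose C = C"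
  proof -
    define A where "A = transpose C - C"
    have "v \<bullet> (A *v v) = 0" for v
      by (simp add: A_def matrix_vector_mult_diff_rdistrib inner_diff_right)
        (metis dot_lmul_matrix inner_commute)
    then have "0 \<le> C \<bullet> A" "0 \<le> C \<bullet> (- A)"
      by (intro neg; simp add: matrix_vector_mult_diff_rdistrib[of 0, simplified])+
    moreover have "transpose C \<bullet> transpose C = C \<bullet> C"
      by (simp add: inner_vec_def transpose_def) (rule sum.swap)
    ultimately have "A \<bullet> A = 0"
      by (simp add: A_def inner_diff_left inner_diff_right inner_transpose)
    then show ?thesis
      by (simp add: A_def)
  qed
  moreover have "v \<bullet> (C *v v) \<le> 0" for v
  proof -
    have "w \<bullet> ((- outer v v) *v w) \<le> 0" for w
      by (simp add: matrix_vector_mult_diff_rdistrib[of 0, simplified] outer_mult_vec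
          inner_commute[of w v])
    from neg[OF this] show ?thesis
      by (simp add: inner_outer)
  qed
  ultimately have psd: "psd (- C)"
    by (simp add: psd_def transpose_def vec_eq_iff
        matrix_vector_mult_diff_rdistrib[of 0, simplified])
  define s where "s = sqrt (\<kappa>1 * (b \<bullet> (\<Sigma> *v b)))"
  have "0 \<le> s"
    using form assms(3) by (simp add: s_def)
  have bound: "c \<le> a * V - s + \<kappa>2 * (C \<bullet> \<Sigma>)"
  proof -
    \<comment> \<open>The point of E that minimises b . u, with value -s; membership in E is the
      Cauchy-Schwarz inequality for \<Sigma>. If s = 0, division by zero gives u = 0. The matching
      extremal point of F is \<kappa>2 \<Sigma>, because C turns out to be negative
      semidefinite.\<close>
    define u where "u = (- \<kappa>1 / s) *\<^sub>R (\<Sigma> *v b)"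
    have "v \<bullet> u \<le> sqrt (\<kappa>1 * (v \<bullet> (\<Sigma> *v v)))" for v
    proof (cases "s = 0")
      case True
      then show ?thesis
        using form assms(3) by (simp add: u_def)
    next
      case False
      have "v \<bullet> u = (\<kappa>1 / s) * ((- v) \<bullet> (\<Sigma> *v b))"
        by (simp add: u_def)
      also have "\<dots> \<le> (\<kappa>1 / s) * (sqrt (v \<bullet> (\<Sigma> *v v)) * sqrt (b \<bullet> (\<Sigma> *v b)))"
        using pos_def_cauchy_schwarz[OF assms(2), of "- v" b] \<open>0 \<le> s\<close> assms(3)
        by (intro mult_left_mono) (simp_all add: linear_neg[OF matrix_vector_mul_linear])
      also have "\<dots> = sqrt (\<kappa>1 * (v \<bullet> (\<Sigma> *v v)))"
        using False assms(3) by (simp add: s_def real_sqrt_mult field_simps)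
      finally show ?thesis .
    qed
    then have "u \<in> E"
      by (simp add: E_def)
    moreover have "b \<bullet> u = - s"
    proof (cases "s = 0")
      case False
      have "\<kappa>1 * (b \<bullet> (\<Sigma> *v b)) = s * s"
        using form assms(3) by (simp add: s_def)
      then show ?thesis
        using False by (simp add: u_def)
    qed (simp add: u_def)
    ultimately have *: "c \<le> a * t - s + \<kappa>2 * (C \<bullet> \<Sigma>)" if "V < t" for t
      using above[OF that _ \<Sigma>_F, of u] by simp
    \<comment> \<open>T contains only values strictly above V, so the bound at V itself is a limit
      from the right.\<close>
    have "((\<lambda>t. a * t - s + \<kappa>2 * (C \<bullet> \<Sigma>)) \<longlongrightarrow> a * V - s + \<kappa>2 * (C \<bullet> \<Sigma>)) (at_right V)"
      by (intro tendsto_intros)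
    then show ?thesis
      by (rule tendsto_lowerbound) (auto intro: eventually_mono[OF eventually_at_right_less] *)
  qed
  \<comment> \<open>If a = 0, the moment of the point mass at \<mu> forces c >= 0, so
    \<open>bound\<close> makes two nonnegative terms sum to at most 0. Positive definiteness of
    \<Sigma> then gives b = 0 and C = 0, against h being nonzero.\<close>
  have "a \<noteq> 0"
  proof
    assume "a = 0"
    then have "0 \<le> c"
      using below[OF assms(6)] by simp
    then have "s + \<kappa>2 * (\<Sigma> \<bullet> (- C)) \<le> 0"
      using bound \<open>a = 0\<close> by (simp add: inner_commute)
    moreover obtain e where "0 < e" "e * norm (- C) \<le> \<Sigma> \<bullet> (- C)"
      using pos_def_inner_coercive[OF assms(2)] psd by metis
    moreover from this have "0 \<le> \<Sigma> \<bullet> (- C)"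
      by (metis less_imp_le mult_nonneg_nonneg norm_ge_zero order_trans)
    then have "0 \<le> \<kappa>2 * (\<Sigma> \<bullet> (- C))"
      using assms(4) by (intro mult_nonneg_nonneg) auto
    ultimately have "s = 0" "\<kappa>2 * (\<Sigma> \<bullet> (- C)) = 0"
      using \<open>0 \<le> s\<close> by linarith+
    then have "b \<bullet> (\<Sigma> *v b) = 0" "e * norm (- C) \<le> 0"
      using assms(3,4) \<open>e * norm (- C) \<le> \<Sigma> \<bullet> (- C)\<close> by (auto simp: s_def)
    then have "b = 0" "C = 0"
      using assms(2) \<open>0 < e\<close> by (auto simp: pos_def_def mult_le_0_iff)
    then show False
      using \<open>h \<noteq> 0\<close> \<open>a = 0\<close> by (simp add: h zero_prod_def)
  qed
  with \<open>0 \<le> a\<close> have "0 < a"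
    by simp
  \<comment> \<open>The hull lies on the side \<open>h \<bullet> y \<le> c\<close>, so solving for k
    divides by a and flips the signs of b and C.\<close>
  define \<Lambda> where "\<Lambda> = (1 / a) *\<^sub>R (- C)"
  define p where "p = (1 / a) *\<^sub>R (- b)"
  define q where "q = p - 2 *\<^sub>R (\<Lambda> *v \<mu>)"
  \<comment> \<open>Chosen so that the majorant of k has value c / a at \<mu>, the constant term of
    its expansion there.\<close>
  define r where "r = c / a - (\<Lambda> *v \<mu> + q) \<bullet> \<mu>"
  have "psd \<Lambda>"
    unfolding \<Lambda>_def using psd \<open>0 < a\<close> by (intro psd_scaleR) auto
  show thesis
  proof (rule that[OF \<open>psd \<Lambda>\<close>], rule ballI)
    fix \<xi> assume "\<xi> \<in> \<Xi>"
    have "r + (\<Lambda> *v \<xi> + q) \<bullet> \<xi> = (c - b \<bullet> (\<xi> - \<mu>) - (\<xi> - \<mu>) \<bullet> (C *v (\<xi> - \<mu>))) / a"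
      unfolding psd_quadratic_shift[OF \<open>psd \<Lambda>\<close>, of \<xi> q \<mu>]
      by (simp add: r_def q_def p_def \<Lambda>_def diff_divide_distrib
          matrix_vector_mult_diff_rdistrib[of 0, simplified] flip: scaleR_matrix_vector_assoc)
    also have "\<dots> \<ge> k \<xi>"
      using below[OF \<open>\<xi> \<in> \<Xi>\<close>] \<open>0 < a\<close> by (simp add: field_simps)
    finally show "k \<xi> \<le> r + (\<Lambda> *v \<xi> + q) \<bullet> \<xi>" .
  next
    have scaled: "\<kappa>1 * (p \<bullet> (\<Sigma> *v p)) = (1 / a)\<^sup>2 * (\<kappa>1 * (b \<bullet> (\<Sigma> *v b)))"
      by (simp add: p_def linear_neg[OF matrix_vector_mul_linear] matrix_vector_mult_scaleR
          power2_eq_square)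
    have "sqrt (\<kappa>1 * (p \<bullet> (\<Sigma> *v p))) = s / a"
      unfolding s_def scaled real_sqrt_mult[of "(1 / a)\<^sup>2"] using \<open>0 < a\<close> by simp
    moreover have "c / a \<le> (a * V - s + \<kappa>2 * (C \<bullet> \<Sigma>)) / a"
      using bound \<open>0 < a\<close> by (intro divide_right_mono) auto
    ultimately show "r + \<kappa>2 * (\<Sigma> \<bullet> \<Lambda>) + (\<Lambda> *v \<mu> + q) \<bullet> \<mu>
        + sqrt (\<kappa>1 * ((q + 2 *\<^sub>R (\<Lambda> *v \<mu>)) \<bullet> (\<Sigma> *v (q + 2 *\<^sub>R (\<Lambda> *v \<mu>))))) \<le> V"
      using \<open>0 < a\<close>
      by (simp add: r_def q_def \<Lambda>_def inner_commute add_divide_distrib diff_divide_distrib)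
  qed
qed

text \<open>In the centred variables the objective is c plus two nonnegative terms, and the
  constraint at \<mu> gives c >= k \<mu>. Hence each term is at most V - k \<mu>, and coercivity of
  \<Sigma> turns this into norm bounds for b and \<Lambda>.\<close>

lemma dual_sublevel_bounded:
  fixes \<Sigma> :: "real^'n^'n" and \<mu> :: "real^'n"
  assumes "pos_def \<Sigma>" "\<kappa>1 > 0" "\<kappa>2 > 0" "\<mu> \<in> \<Xi>"
  shows "bounded {(r, q, \<Lambda>). psd \<Lambda> \<and> (\<forall>\<xi>\<in>\<Xi>. k \<xi> \<le> r + (\<Lambda> *v \<xi> + q) \<bullet> \<xi>) \<and>
    r + \<kappa>2 * (\<Sigma> \<bullet> \<Lambda>) + (\<Lambda> *v \<mu> + q) \<bullet> \<mu>
      + sqrt (\<kappa>1 * ((q + 2 *\<^sub>R (\<Lambda> *v \<mu>)) \<bullet> (\<Sigma> *v (q + 2 *\<^sub>R (\<Lambda> *v \<mu>))))) \<le> V}"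
    (is "bounded ?S")
proof -
  obtain a where a: "0 < a" "\<And>v. a * (norm v)\<^sup>2 \<le> v \<bullet> (\<Sigma> *v v)"
    using pos_def_coercive[OF assms(1)] by blast
  obtain e where e: "0 < e" "\<And>N. psd N \<Longrightarrow> e * norm N \<le> \<Sigma> \<bullet> N"
    using pos_def_inner_coercive[OF assms(1)] by blast
  define D where "D = V - k \<mu>"
  \<comment> \<open>The inverse of the centring. It is continuous, so it maps the compact box of
    centred variables to a bounded set.\<close>
  define g where "g = (\<lambda>(c :: real, b :: real^'n, \<Lambda> :: real^'n^'n). (c - (\<Lambda> *v \<mu> + (b - 2 *\<^sub>R (\<Lambda> *v \<mu>))) \<bullet> \<mu>,
    b - 2 *\<^sub>R (\<Lambda> *v \<mu>), \<Lambda>))"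
  let ?K = "{k \<mu>..V} \<times> cball 0 (D / sqrt (\<kappa>1 * a)) \<times> cball 0 (D / (\<kappa>2 * e))"
  have lin: "continuous_on A (\<lambda>x. (F x) *v \<mu>)" if "continuous_on A F"
    for A and F :: "real \<times> (real^'n) \<times> (real^'n^'n) \<Rightarrow> real^'n^'n"
    using bounded_linear.continuous_on[OF bounded_linear_matrix_vector_left that] .
  have "?S \<subseteq> g ` ?K"
  proof clarify
    fix r :: real and q :: "real^'n" and \<Lambda> :: "real^'n^'n"
    define b where "b = q + 2 *\<^sub>R (\<Lambda> *v \<mu>)"
    define c where "c = r + (\<Lambda> *v \<mu> + q) \<bullet> \<mu>"
    let ?s = "sqrt (\<kappa>1 * (b \<bullet> (\<Sigma> *v b)))"
    assume "psd \<Lambda>" and le: "\<forall>\<xi>\<in>\<Xi>. k \<xi> \<le> r + (\<Lambda> *v \<xi> + q) \<bullet> \<xi>"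
      and "r + \<kappa>2 * (\<Sigma> \<bullet> \<Lambda>) + (\<Lambda> *v \<mu> + q) \<bullet> \<mu>
      + sqrt (\<kappa>1 * ((q + 2 *\<^sub>R (\<Lambda> *v \<mu>)) \<bullet> (\<Sigma> *v (q + 2 *\<^sub>R (\<Lambda> *v \<mu>))))) \<le> V"
    then have V: "c + \<kappa>2 * (\<Sigma> \<bullet> \<Lambda>) + ?s \<le> V"
      by (simp add: b_def c_def)
    have c: "k \<mu> \<le> c"
      using le assms(4) by (simp add: c_def)
    have \<Lambda>: "\<kappa>2 * (e * norm \<Lambda>) \<le> \<kappa>2 * (\<Sigma> \<bullet> \<Lambda>)"
      using e(2)[OF \<open>psd \<Lambda>\<close>] assms(3) by (intro mult_left_mono) auto
    have "0 \<le> \<kappa>2 * (e * norm \<Lambda>)"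
      using e(1) assms(3) by simp
    have "sqrt (\<kappa>1 * a) * norm b = sqrt (\<kappa>1 * (a * (norm b)\<^sup>2))"
      by (simp add: real_sqrt_mult)
    also have "\<dots> \<le> ?s"
      using a(2)[of b] assms(2) by simp
    finally have b: "sqrt (\<kappa>1 * a) * norm b \<le> ?s" .
    have "0 \<le> sqrt (\<kappa>1 * a) * norm b"
      using a(1) assms(2) by simp
    have "c \<le> V" "\<kappa>2 * e * norm \<Lambda> \<le> D" "sqrt (\<kappa>1 * a) * norm b \<le> D"
      using V c \<Lambda> b \<open>0 \<le> \<kappa>2 * (e * norm \<Lambda>)\<close> \<open>0 \<le> sqrt (\<kappa>1 * a) * norm b\<close>
      unfolding D_def mult.assoc[of \<kappa>2] by linarith+
    then have "(c, b, \<Lambda>) \<in> ?K"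
      using c a(1) e(1) assms(2,3) by (simp add: pos_le_divide_eq mult.commute)
    moreover have "g (c, b, \<Lambda>) = (r, q, \<Lambda>)"
      by (simp add: g_def b_def c_def)
    ultimately show "(r, q, \<Lambda>) \<in> g ` ?K"
      by force
  qed
  moreover have "compact (g ` ?K)"
    unfolding g_def case_prod_beta
    by (intro compact_continuous_image compact_Times compact_Icc compact_cball)
      (intro continuous_intros lin)
  ultimately show ?thesis
    using compact_imp_bounded bounded_subset by blast
qed

lemma sample_mean_in_convex:
  assumes "convex S" "set obs \<subseteq> S" "obs \<noteq> []"
  shows "sample_mean obs \<in> S"
proof -
  have "sample_mean obs = (\<Sum>i<length obs. (1 / real (length obs)) *\<^sub>R obs ! i)"
    by (simp add: sample_mean_def sum_list_sum_nth atLeast0LessThan scaleR_sum_right)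
  also have "\<dots> \<in> S"
    using assms by (intro convex_sum) auto
  finally show ?thesis .
qed

theorem proposition2p2:
  fixes \<Xi> :: "(real^('d::finite option)) set"
    and obs :: "(real^('d option)) list"
    and \<mu> :: "real^('d option)"
    and \<Sigma> :: "real^('d option)^('d option)"
    and \<psi> :: "real \<Rightarrow> real"
    and \<tau>1 \<tau>2 \<beta> \<kappa>1 \<kappa>2 \<alpha> :: real
    and x :: "real^'d"
  assumes "convex \<Xi>" and "compact \<Xi>"
    and "obs \<noteq> []" and "set obs \<subseteq> \<Xi>"
    and "\<mu> = sample_mean obs"
    and "\<Sigma> = sample_covariance (length obs) obs \<or> \<Sigma> = sample_covariance (length obs - 1) obs"
    and "pos_def \<Sigma>"
    and "convex_on UNIV \<psi>"
    and "\<tau>1 \<ge> 0" and "\<tau>2 \<ge> 0"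
    and "0 < \<beta>" and "\<beta> < 1"
    and "x \<in> std_simplex"
    and "\<kappa>1 > 0" and "\<kappa>2 > 0"
  shows "primal_value \<psi> \<tau>1 \<tau>2 \<beta> \<Xi> \<mu> \<Sigma> \<kappa>1 \<kappa>2 x \<alpha> = dual_value \<psi> \<tau>1 \<tau>2 \<beta> \<Xi> \<mu> \<Sigma> \<kappa>1 \<kappa>2 x \<alpha>
       \<and> dual_solutions \<psi> \<tau>1 \<tau>2 \<beta> \<Xi> \<mu> \<Sigma> \<kappa>1 \<kappa>2 x \<alpha> \<noteq> {}
       \<and> bounded (dual_solutions \<psi> \<tau>1 \<tau>2 \<beta> \<Xi> \<mu> \<Sigma> \<kappa>1 \<kappa>2 x \<alpha>)"
proof -
  let ?K = "K_hat \<psi> \<tau>1 \<tau>2 \<beta> x \<alpha>"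
  let ?PF = "primal_feasible \<Xi> \<mu> \<Sigma> \<kappa>1 \<kappa>2"
  let ?DF = "dual_feasible \<psi> \<tau>2 \<beta> \<Xi> x \<alpha>"
  let ?obj = "dual_objective \<tau>1 \<tau>2 \<mu> \<Sigma> \<kappa>1 \<kappa>2 x \<alpha>"
  \<comment> \<open>The part of \<open>K_hat\<close> that does not depend on \<xi>; it also occurs
    in \<open>h1\<close> and shifts both values equally.\<close>
  define k0 where "k0 = \<tau>1 * (norm x)\<^sup>2 + \<tau>2 * \<alpha>"
  define k where "k \<xi> = \<psi> (part_a \<xi> - part_B \<xi> \<bullet> x)
    + \<tau>2 / (1 - \<beta>) * max (- (x \<bullet> part_B \<xi>) - \<alpha>) 0" for \<xi>
  \<comment> \<open>Convexity of \<Xi> enters here: it makes the point mass at the sample mean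
    admissible.\<close>
  have \<mu>: "\<mu> \<in> \<Xi>"
    using sample_mean_in_convex assms(1,3,4,5) by blast
  have K: "?K \<xi> = k \<xi> + k0" for \<xi>
    by (simp add: K_hat_def k_def k0_def)
  have part_B: "continuous_on \<Xi> part_B" and part_a: "continuous_on \<Xi> part_a"
    unfolding part_B_def part_a_def by (intro continuous_intros)+
  have "continuous_on UNIV \<psi>"
    using convex_on_continuous[OF open_UNIV assms(8)] .
  then have cont: "continuous_on \<Xi> k"
    unfolding k_def
    by (intro continuous_intros part_B part_a
        continuous_on_compose2[of UNIV \<psi> \<Xi> "\<lambda>\<xi>. part_a \<xi> - part_B \<xi> \<bullet> x"]) auto
  have DF: "(r, q, \<Lambda>) \<in> ?DF \<longleftrightarrow> psd \<Lambda> \<and> (\<forall>\<xi>\<in>\<Xi>. k \<xi> \<le> r + (\<Lambda> *v \<xi> + q) \<bullet> \<xi>)" for r q \<Lambda>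
  proof -
    have "h2 \<psi> \<tau>2 \<beta> \<xi> x \<alpha> q \<Lambda> = k \<xi> - (\<Lambda> *v \<xi> + q) \<bullet> \<xi>" if "psd \<Lambda>" for \<xi>
      using that by (simp add: h2_def k_def psd_def del: transpose_matrix_vector)
    then show ?thesis
      by (auto simp: dual_feasible_def diff_le_eq)
  qed
  have obj: "?obj (r, q, \<Lambda>) = r + \<kappa>2 * (\<Sigma> \<bullet> \<Lambda>) + (\<Lambda> *v \<mu> + q) \<bullet> \<mu>
      + sqrt (\<kappa>1 * ((q + 2 *\<^sub>R (\<Lambda> *v \<mu>)) \<bullet> (\<Sigma> *v (q + 2 *\<^sub>R (\<Lambda> *v \<mu>))))) + k0"
    if "psd \<Lambda>" for r q \<Lambda>
    using that by (simp add: h1_def psd_def norm_mat_sqrt[OF assms(7)] real_sqrt_mult k0_def)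
  have PB: "P \<in> borel_prob_measures \<Xi>" if "P \<in> ?PF" for P
    using that by (simp add: primal_feasible_def)
  have intK: "(LINT \<xi>|P. ?K \<xi>) = (LINT \<xi>|P. k \<xi>) + k0" if "P \<in> ?PF" for P
  proof -
    interpret prob_space P
      using PB[OF that] by (simp add: borel_prob_measures_def)
    show ?thesis
      using integrable_borel_prob_measures[OF PB[OF that] assms(2) cont] by (simp add: K prob_space)
  qed
  have weak: "(LINT \<xi>|P. ?K \<xi>) \<le> ?obj z" if "P \<in> ?PF" "z \<in> ?DF" for P z
  proof -
    obtain r q \<Lambda> where z: "z = (r, q, \<Lambda>)"
      by (cases z)
    then have "psd \<Lambda>" "\<And>\<xi>. \<xi> \<in> \<Xi> \<Longrightarrow> k \<xi> \<le> r + (\<Lambda> *v \<xi> + q) \<bullet> \<xi>"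
      using that(2) by (auto simp: DF)
    from weak_duality[OF assms(2,7,14) cont that(1) this] show ?thesis
      unfolding z obj[OF \<open>psd \<Lambda>\<close>] intK[OF that(1)] by simp
  qed
  \<comment> \<open>Under the point mass at \<mu> all deviations vanish. Together with the bound M
    below, a nonempty feasible set makes V a genuine real supremum.\<close>
  obtain P0 where P0: "P0 \<in> ?PF"
  proof -
    obtain P where P: "P \<in> borel_prob_measures \<Xi>"
      and "\<And>f :: real^('d option) \<Rightarrow> real. continuous_on \<Xi> f \<Longrightarrow>
        (LINT \<xi>|P. f \<xi>) = (\<Sum>i=1..1::nat. 1 * f \<mu>)"
      using finite_support_borel_prob_measure[of 1 "\<lambda>_. 1" "\<lambda>_. \<mu>" \<Xi>] \<mu> by auto
    then have dirac: "(LINT \<xi>|P. f \<xi>) = f \<mu>" if "continuous_on \<Xi> f"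
      for f :: "real^('d option) \<Rightarrow> real"
      using that by simp
    have "(LINT \<xi>|P. v \<bullet> (\<xi> - \<mu>)) = 0" "(LINT \<xi>|P. (v \<bullet> (\<xi> - \<mu>))\<^sup>2) = 0" for v
      by (subst dirac; auto intro!: continuous_intros)+
    moreover have "0 \<le> v \<bullet> (\<Sigma> *v v)" for v
      using pos_def_imp_psd[OF assms(7)] by (simp add: psd_def)
    ultimately have "P \<in> ?PF"
      using P assms(14,15) by (simp add: primal_feasible_iff[OF assms(2,7,14)])
    then show thesis
      by (rule that)
  qed
  obtain M where M: "\<And>\<xi>. \<xi> \<in> \<Xi> \<Longrightarrow> k \<xi> \<le> M"
    using continuous_attains_sup[OF assms(2) _ cont] \<mu> by blast
  have le_M: "(LINT \<xi>|P. k \<xi>) \<le> M" if "P \<in> ?PF" for P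
  proof -
    interpret prob_space P
      using PB[OF that] by (simp add: borel_prob_measures_def)
    have "space P = \<Xi>"
      using PB[OF that] sets_eq_imp_space_eq[of P "restrict_space borel \<Xi>"]
      by (auto simp: borel_prob_measures_def space_restrict_space)
    then show ?thesis
      using M integrable_borel_prob_measures[OF PB[OF that] assms(2) cont]
      by (intro integral_le_const) auto
  qed
  define V where "V = (SUP P\<in>?PF. LINT \<xi>|P. k \<xi>)"
  have le_V: "(LINT \<xi>|P. k \<xi>) \<le> V" if "P \<in> ?PF" for P
    unfolding V_def using that bdd_aboveI2[OF le_M] by (rule cSUP_upper)
  obtain r q \<Lambda> where "psd \<Lambda>" "\<forall>\<xi>\<in>\<Xi>. k \<xi> \<le> r + (\<Lambda> *v \<xi> + q) \<bullet> \<xi>"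
    "r + \<kappa>2 * (\<Sigma> \<bullet> \<Lambda>) + (\<Lambda> *v \<mu> + q) \<bullet> \<mu>
      + sqrt (\<kappa>1 * ((q + 2 *\<^sub>R (\<Lambda> *v \<mu>)) \<bullet> (\<Sigma> *v (q + 2 *\<^sub>R (\<Lambda> *v \<mu>))))) \<le> V"
    by (rule strong_duality[OF assms(2,7,14,15) cont \<mu> le_V]) (assumption | rule that)+
  then have "(r, q, \<Lambda>) \<in> ?DF" "?obj (r, q, \<Lambda>) \<le> V + k0"
    unfolding DF obj[OF \<open>psd \<Lambda>\<close>] by auto
  then obtain z where z: "z \<in> ?DF" "?obj z \<le> V + k0"
    by blast
  have V_le: "V + k0 \<le> ?obj z'" if "z' \<in> ?DF" for z'
  proof -
    have "(LINT \<xi>|P. k \<xi>) \<le> ?obj z' - k0" if "P \<in> ?PF" for P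
      using weak[OF that \<open>z' \<in> ?DF\<close>] unfolding intK[OF that] by linarith
    then have "V \<le> ?obj z' - k0"
      unfolding V_def using P0 by (intro cSUP_least) auto
    then show ?thesis
      by simp
  qed
  have sol: "z \<in> dual_solutions \<psi> \<tau>1 \<tau>2 \<beta> \<Xi> \<mu> \<Sigma> \<kappa>1 \<kappa>2 x \<alpha>"
    using z V_le by (auto simp: dual_solutions_def intro: order_trans)
  \<comment> \<open>Transfers the real supremum to the extended reals; the value plus infinity is
    trivial and minus infinity is excluded by P0.\<close>
  have "ereal (V + k0) \<le> primal_value \<psi> \<tau>1 \<tau>2 \<beta> \<Xi> \<mu> \<Sigma> \<kappa>1 \<kappa>2 x \<alpha>"
  proof (cases "primal_value \<psi> \<tau>1 \<tau>2 \<beta> \<Xi> \<mu> \<Sigma> \<kappa>1 \<kappa>2 x \<alpha>")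
    case (real p)
    then have "(LINT \<xi>|P. k \<xi>) \<le> p - k0" if "P \<in> ?PF" for P
      using SUP_upper[OF that, of "\<lambda>P. ereal (LINT \<xi>|P. ?K \<xi>)"] intK[OF that]
      by (simp add: primal_value_def)
    then have "V \<le> p - k0"
      unfolding V_def using P0 by (intro cSUP_least) auto
    then show ?thesis
      by (simp add: real)
  next
    case MInf
    then show ?thesis
      using SUP_upper[OF P0, of "\<lambda>P. ereal (LINT \<xi>|P. ?K \<xi>)"] by (simp add: primal_value_def)
  qed simp
  moreover have "primal_value \<psi> \<tau>1 \<tau>2 \<beta> \<Xi> \<mu> \<Sigma> \<kappa>1 \<kappa>2 x \<alpha> \<le> dual_value \<psi> \<tau>1 \<tau>2 \<beta> \<Xi> \<mu> \<Sigma> \<kappa>1 \<kappa>2 x \<alpha>"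
    unfolding primal_value_def dual_value_def by (intro SUP_least INF_greatest) (simp add: weak)
  moreover have "dual_value \<psi> \<tau>1 \<tau>2 \<beta> \<Xi> \<mu> \<Sigma> \<kappa>1 \<kappa>2 x \<alpha> \<le> ereal (?obj z)"
    unfolding dual_value_def by (rule INF_lower[OF z(1)])
  moreover have "ereal (?obj z) \<le> ereal (V + k0)"
    using z(2) by simp
  ultimately have "primal_value \<psi> \<tau>1 \<tau>2 \<beta> \<Xi> \<mu> \<Sigma> \<kappa>1 \<kappa>2 x \<alpha> = dual_value \<psi> \<tau>1 \<tau>2 \<beta> \<Xi> \<mu> \<Sigma> \<kappa>1 \<kappa>2 x \<alpha>"
    by (meson order_antisym order_trans)
  \<comment> \<open>Every optimal solution does at least as well as z, so it lies in the sublevel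
    set of level V.\<close>
  moreover have "dual_solutions \<psi> \<tau>1 \<tau>2 \<beta> \<Xi> \<mu> \<Sigma> \<kappa>1 \<kappa>2 x \<alpha> \<subseteq>
    {(r, q, \<Lambda>). psd \<Lambda> \<and> (\<forall>\<xi>\<in>\<Xi>. k \<xi> \<le> r + (\<Lambda> *v \<xi> + q) \<bullet> \<xi>) \<and>
    r + \<kappa>2 * (\<Sigma> \<bullet> \<Lambda>) + (\<Lambda> *v \<mu> + q) \<bullet> \<mu>
      + sqrt (\<kappa>1 * ((q + 2 *\<^sub>R (\<Lambda> *v \<mu>)) \<bullet> (\<Sigma> *v (q + 2 *\<^sub>R (\<Lambda> *v \<mu>))))) \<le> V}"
  proof clarify
    fix r q \<Lambda>
    assume *: "(r, q, \<Lambda>) \<in> dual_solutions \<psi> \<tau>1 \<tau>2 \<beta> \<Xi> \<mu> \<Sigma> \<kappa>1 \<kappa>2 x \<alpha>"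
    then have feas: "psd \<Lambda> \<and> (\<forall>\<xi>\<in>\<Xi>. k \<xi> \<le> r + (\<Lambda> *v \<xi> + q) \<bullet> \<xi>)"
      unfolding dual_solutions_def using DF by blast
    have "?obj (r, q, \<Lambda>) \<le> V + k0"
      using * z unfolding dual_solutions_def by (blast intro: order_trans)
    then show "psd \<Lambda> \<and> (\<forall>\<xi>\<in>\<Xi>. k \<xi> \<le> r + (\<Lambda> *v \<xi> + q) \<bullet> \<xi>) \<and>
      r + \<kappa>2 * (\<Sigma> \<bullet> \<Lambda>) + (\<Lambda> *v \<mu> + q) \<bullet> \<mu>
      + sqrt (\<kappa>1 * ((q + 2 *\<^sub>R (\<Lambda> *v \<mu>)) \<bullet> (\<Sigma> *v (q + 2 *\<^sub>R (\<Lambda> *v \<mu>))))) \<le> V"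
      using feas unfolding obj[OF conjunct1[OF feas]] by simp
  qed
  then have "bounded (dual_solutions \<psi> \<tau>1 \<tau>2 \<beta> \<Xi> \<mu> \<Sigma> \<kappa>1 \<kappa>2 x \<alpha>)"
    using bounded_subset[OF dual_sublevel_bounded[OF assms(7,14,15) \<mu>]] by blast
  ultimately show ?thesis
    using sol by blast
qed

end
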